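(* Let $p\in[0,1]$ and let $(c(e))_{e\in E}$ be i.i.d. Bernoulli random variables with parameter $p$ indexed by the edges of $\mathbb L$. Then the random variable $v(z)$ (the value of the game $\Gamma(z)$) does not depend on $z$ and is deterministic: there exists a constant $v_p\in[0,1]$ such that, almost surely, $v(z)=v_p$ for all $z\in\mathbb L$.
   Context: Graph. $\mathbb L=\{(x,y)\in\mathbb Z^2: x+y \text{ is even}\}$, with an edge between two points exactly when they are at Euclidean distance $\sqrt2$. So the neighbours of $(x,y)$ are $(x\pm1,y\pm1)$. $E$ is the set of (non-oriented) edges of $\mathbb L$. Each edge $e$ carries a cost $c(e)\in\{0,1\}$ (open if $1$, closed if $0$). Game. For a fixed realization of $(c(e))_{e\in E}$ (known to both players from the start) and $z\in\mathbb L$, the zero-sum game $\Gamma(z)$ is as follows. A token is placed at $z$. At each stage $m\ge1$, Player 1 selects an action in $\{T,B\}$ and announces it; then Player 2 selects an action in $\{L,R\}$. If the token is at $(x,y)$, it moves to $(x+1,y+1)$ if $(T,R)$ is played, to $(x-1,y+1)$ if $(T,L)$, to $(x+1,y-1)$ if $(B,R)$, to $(x-1,y-1)$ if $(B,L)$. Let $e_m$ be the edge crossed at stage $m$. The history at stage $m$ is $(e_1,\dots,e_{m-1})$, and $H=\bigcup_{m\ge1}E^{m-1}$. A strategy of Player 1 is a map $\sigma:H\to\{T,B\}$; a strategy of Player 2 is a map $\tau:H\to\{L,R\}^2$, whose first (resp. second) component is the action played when Player 1 plays $T$ (resp. $B$) at that stage. The sets of strategies are $\Sigma$ and $\mathcal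 T$. Player 1 minimizes and Player 2 maximizes the total cost $$\gamma(z,\sigma,\tau)=\limsup_{n\to+\infty}\frac1n\sum_{m=1}^n c(e_m).$$ The game $\Gamma(z)$ has a value $$v(z)=\inf_{\sigma\in\Sigma}\sup_{\tau\in\mathcal T}\gamma(z,\sigma,\tau)=\sup_{\tau\in\mathcal T}\inf_{\sigma\in\Sigma}\gamma(z,\sigma,\tau),$$ which is a random variable as a function of $(c(e))_{e\in E}$; measurability is always with respect to the completed $\sigma$-algebra generated by $(c(e))_{e\in E}$. *)

theory Defs
  imports "HOL-Probability.Probability"
begin

type_synonym site = "int \<times> int"
type_synonym edge = "site set"

definition sites :: "site set" where
  "sites = {(x, y). even (x + y)}"

definition site_dist :: "site \<Rightarrow> site \<Rightarrow> real" where
  "site_dist u v =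
     dist (real_of_int (fst u), real_of_int (snd u)) (real_of_int (fst v), real_of_int (snd v))"

definition edges :: "edge set" where
  "edges = {{u, v} | u v. u \<in> sites \<and> v \<in> sites \<and> site_dist u v = sqrt 2}"

datatype action1 = T | B
datatype action2 = L | R

text \<open>Strategies are total functions on lists of arbitrary sets of points. Histories are lists of
  elements of \<^term>\<open>edges\<close>, and the values of a strategy at other lists never influence a play
  started in \<^term>\<open>sites\<close>.\<close>

type_synonym history = "edge list"
type_synonym strategy1 = "history \<Rightarrow> action1"
type_synonym strategy2 = "history \<Rightarrow> action2 \<times> action2"

fun reply :: "action2 \<times> action2 \<Rightarrow> action1 \<Rightarrow> action2" where
  "reply (t, b) T = t"
| "reply (t, b) B = b"

fun move :: "site \<Rightarrow> action1 \<Rightarrow> action2 \<Rightarrow> site" where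
  "move (x, y) T R = (x + 1, y + 1)"
| "move (x, y) T L = (x - 1, y + 1)"
| "move (x, y) B R = (x + 1, y - 1)"
| "move (x, y) B L = (x - 1, y - 1)"

text \<open>The position of the token, and the edges crossed so far in order, after \<open>n\<close> stages.\<close>

primrec play :: "site \<Rightarrow> strategy1 \<Rightarrow> strategy2 \<Rightarrow> nat \<Rightarrow> site \<times> history" where
  "play z \<sigma> \<tau> 0 = (z, [])"
| "play z \<sigma> \<tau> (Suc n) =
     (let (w, h) = play z \<sigma> \<tau> n; w' = move w (\<sigma> h) (reply (\<tau> h) (\<sigma> h))
      in (w', h @ [{w, w'}]))"

text \<open>The edge crossed at stage \<open>m\<close>, meaningful for \<open>m \<ge> 1\<close>.\<close>

definition crossed :: "site \<Rightarrow> strategy1 \<Rightarrow> strategy2 \<Rightarrow> nat \<Rightarrow> edge" where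
  "crossed z \<sigma> \<tau> m = {fst (play z \<sigma> \<tau> (m - 1)), fst (play z \<sigma> \<tau> m)}"

text \<open>A realization of the costs is a map \<open>c\<close> into \<^typ>\<open>bool\<close>: the cost of \<open>e\<close> is 1 (open) if
  \<open>c e\<close> holds and 0 (closed) otherwise. Payoffs are extended reals because
  \<^const>\<open>limsup\<close> needs a complete lattice; all of them lie between 0 and 1.\<close>

definition payoff :: "(edge \<Rightarrow> bool) \<Rightarrow> site \<Rightarrow> strategy1 \<Rightarrow> strategy2 \<Rightarrow> ereal" where
  "payoff c z \<sigma> \<tau> =
     limsup (\<lambda>n. ereal (1 / real n * (\<Sum>m = 1..n. of_bool (c (crossed z \<sigma> \<tau> m)))))"

definition is_game_value :: "(edge \<Rightarrow> bool) \<Rightarrow> site \<Rightarrow> real \<Rightarrow> bool" where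
  "is_game_value c z v \<longleftrightarrow>
     ereal v = (INF \<sigma>. SUP \<tau>. payoff c z \<sigma> \<tau>) \<and>
     ereal v = (SUP \<tau>. INF \<sigma>. payoff c z \<sigma> \<tau>)"

end

theory Submission
  imports Defs
begin

text \<open>For a fixed realization, Player 2 guarantees that the running average exceeds \<open>q\<close> infinitely often
  exactly on a greatest fixed point, and on its complement Player 1 guarantees the opposite. This gives the
  existence of the value and, up to null sets, its measurability.

  For a threshold \<open>q\<close> let \<open>A = {v > q}\<close> and \<open>C = {v < q}\<close>. Player 2 can stay in \<open>A\<close>, so each site of \<open>A\<close>
  lies on a vertical path in \<open>A\<close>. Player 1 can stay in \<open>C\<close>, so each site of \<open>C\<close> lies on a horizontal path
  in \<open>C\<close>. Two such paths avoid each other only if the vertical one ends with a diagonal ray, hence \<open>A\<close>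
  contains a diagonal ray whenever both sets are nonempty. By ergodicity of the translations this almost
  surely does not happen unless \<open>A\<close> is almost surely the whole lattice. So the value does not depend on
  the site, and then it is almost surely deterministic, again by ergodicity.\<close>

section \<open>Infinite games with a recurrence objective\<close>

text \<open>The controllable predecessor for the second player. The order of the quantifiers
  reflects that the reply is chosen after \<open>a\<close> is announced.\<close>

definition cpre :: "('s \<Rightarrow> 'a \<Rightarrow> 'b \<Rightarrow> 's) \<Rightarrow> 's set \<Rightarrow> 's set" where
  "cpre succ X = {s. \<forall>a. \<exists>b. succ s a b \<in> X}"

text \<open>Attractor stages: within \<open>n\<close> moves the second player can force a state of
  \<open>acc\<close> from which the following move can be forced into \<open>X\<close>.\<close>

primrec reach :: "('s \<Rightarrow> 'a \<Rightarrow> 'b \<Rightarrow> 's) \<Rightarrow> 's set \<Rightarrow> 's set \<Rightarrow> nat \<Rightarrow> 's set" where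
  "reach succ acc X 0 = acc \<inter> cpre succ X"
| "reach succ acc X (Suc n) = acc \<inter> cpre succ X \<union> cpre succ (reach succ acc X n)"

text \<open>Its greatest fixed point is the winning region of the Buechi game in which the second
  player wants to see \<open>acc\<close> infinitely often.\<close>

definition recur :: "('s \<Rightarrow> 'a \<Rightarrow> 'b \<Rightarrow> 's) \<Rightarrow> 's set \<Rightarrow> 's set \<Rightarrow> 's set" where
  "recur succ acc X = (\<Union>n. reach succ acc X n)"

lemma cpre_mono: "X \<subseteq> Y \<Longrightarrow> cpre succ X \<subseteq> cpre succ Y"
  unfolding cpre_def by blast

lemma reach_mono: "X \<subseteq> Y \<Longrightarrow> reach succ acc X n \<subseteq> reach succ acc Y n"
proof (induction n)
  case 0
  then show ?case using cpre_mono[of X Y succ] by auto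
next
  case (Suc n)
  then show ?case
    using cpre_mono[of X Y succ] cpre_mono[of "reach succ acc X n" "reach succ acc Y n" succ] by auto
qed

lemma mono_recur: "mono (recur succ acc)"
  unfolding recur_def by (intro monoI UN_mono reach_mono) auto

lemma reach_Suc_mono: "reach succ acc X n \<subseteq> reach succ acc X (Suc n)"
proof (induction n)
  case (Suc n)
  then show ?case using cpre_mono[OF Suc] by auto
qed auto

lemma incseq_reach: "incseq (reach succ acc X)"
  using reach_Suc_mono by (rule incseq_SucI)

text \<open>With finitely many actions \<open>a\<close>, the stages needed after each of them have a
  maximum. Hence the attractor closes after \<omega> stages and no transfinite iteration is
  required.\<close>

lemma cpre_recur:
  fixes succ :: "'s \<Rightarrow> 'a \<Rightarrow> 'b \<Rightarrow> 's"
  assumes "finite (UNIV :: 'a set)"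
  shows "cpre succ (recur succ acc X) \<subseteq> recur succ acc X"
proof
  fix s assume "s \<in> cpre succ (recur succ acc X)"
  then have "\<forall>a. \<exists>n b. succ s a b \<in> reach succ acc X n"
    unfolding cpre_def recur_def by blast
  then obtain n where n: "\<And>a. \<exists>b. succ s a b \<in> reach succ acc X (n a)" by metis
  have le: "n a \<le> Max (range n)" for a
    using assms by (intro Max_ge) auto
  have "\<exists>b. succ s a b \<in> reach succ acc X (Max (range n))" for a
    using n[of a] incseqD[OF incseq_reach[of succ acc X] le[of a]] by blast
  then have "s \<in> reach succ acc X (Suc (Max (range n)))"
    by (auto simp: cpre_def)
  then show "s \<in> recur succ acc X"
    unfolding recur_def by blast
qed

text \<open>The rank of a winning state is its first attractor stage. A positional reply can keep
  the play winning and lower the rank whenever the state is outside \<open>acc\<close>, so visits to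
  \<open>acc\<close> can never stop.\<close>

lemma recur_strategy:
  fixes succ :: "'s \<Rightarrow> 'a \<Rightarrow> 'b \<Rightarrow> 's"
  shows "\<exists>\<beta>. \<forall>r. r 0 \<in> gfp (recur succ acc) \<longrightarrow> (\<forall>n. \<exists>a. r (Suc n) = succ (r n) a (\<beta> (r n) a))
    \<longrightarrow> infinite {n. r n \<in> acc}"
proof -
  define W where "W = gfp (recur succ acc)"
  have W: "W = (\<Union>n. reach succ acc W n)"
    unfolding W_def by (subst gfp_unfold[OF mono_recur]) (simp add: recur_def)
  define rank where "rank s = (LEAST n. s \<in> reach succ acc W n)" for s
  have rank: "s \<in> reach succ acc W (rank s)" if "s \<in> W" for s
    unfolding rank_def by (rule LeastI_ex) (use that W in blast)
  have step: "\<exists>b. succ s a b \<in> W \<and> (s \<in> acc \<or> rank (succ s a b) < rank s)"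
    if sW: "s \<in> W" for s a
  proof (cases "rank s")
    case 0
    then show ?thesis using rank[OF sW] by (auto simp: cpre_def)
  next
    case (Suc k)
    show ?thesis
    proof (cases "s \<in> acc \<inter> cpre succ W")
      case True
      then show ?thesis by (auto simp: cpre_def)
    next
      case False
      then obtain b where b: "succ s a b \<in> reach succ acc W k"
        using rank[OF sW] Suc by (auto simp: cpre_def)
      have "rank (succ s a b) \<le> k"
        unfolding rank_def using b by (rule Least_le)
      moreover have "succ s a b \<in> W" using b by (subst W) blast
      ultimately show ?thesis using Suc by (auto simp: less_Suc_eq_le)
    qed
  qed
  then obtain \<beta> where \<beta>: "\<And>s a. s \<in> W \<Longrightarrow>
      succ s a (\<beta> s a) \<in> W \<and> (s \<in> acc \<or> rank (succ s a (\<beta> s a)) < rank s)"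
    by metis
  have "infinite {n. r n \<in> acc}"
    if r0: "r 0 \<in> W" and run: "\<forall>n. \<exists>a. r (Suc n) = succ (r n) a (\<beta> (r n) a)" for r
  proof -
    have rW: "r n \<in> W" for n
    proof (induction n)
      case (Suc n)
      then show ?case using run[rule_format, of n] \<beta>[OF Suc] by auto
    qed (use r0 in simp)
    have "\<exists>m\<ge>n. r m \<in> acc" for n
    proof (induction "rank (r n)" arbitrary: n rule: less_induct)
      case less
      show ?case
      proof (cases "r n \<in> acc")
        case False
        then have "rank (r (Suc n)) < rank (r n)"
          using run[rule_format, of n] \<beta>[OF rW[of n]] by auto
        from less[OF this] show ?thesis using Suc_leD by blast
      qed auto
    qed
    then show ?thesis
      unfolding infinite_nat_iff_unbounded_le by auto
  qed
  then show ?thesis unfolding W_def by blast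
qed

text \<open>A positional strategy of the first player is the graph of a partial function. A maximal one
  that keeps the play in its domain and lets it visit \<open>acc\<close> only finitely often is defined on the
  whole complement of the greatest fixed point: otherwise it could be extended by the moves that avoid
  \<^term>\<open>recur succ acc (- Domain g)\<close>. Zorn's lemma replaces a transfinite recursion here.\<close>

lemma avoid_strategy:
  fixes succ :: "'s \<Rightarrow> 'a \<Rightarrow> 'b \<Rightarrow> 's"
  assumes fin: "finite (UNIV :: 'a set)"
  shows "\<exists>\<alpha>. \<forall>r. r 0 \<notin> gfp (recur succ acc) \<longrightarrow> (\<forall>n. \<exists>b. r (Suc n) = succ (r n) (\<alpha> (r n)) b)
    \<longrightarrow> finite {n. r n \<in> acc}"
proof -
  define run where "run g r \<longleftrightarrow> (\<forall>n. \<exists>a b. (r n, a) \<in> g \<and> r (Suc n) = succ (r n) a b)"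
    for g :: "('s \<times> 'a) set" and r :: "nat \<Rightarrow> 's"
  \<comment> \<open>Partial winning strategies of the first player: closed under every reply, and
    each run inside the domain visits \<open>acc\<close> finitely often.\<close>
  define \<G> where "\<G> = {g. single_valued g \<and> (\<forall>s a b. (s, a) \<in> g \<longrightarrow> succ s a b \<in> Domain g) \<and>
      (\<forall>r. run g r \<longrightarrow> finite {n. r n \<in> acc})}"
  have suffix: "finite {n. r n \<in> acc}" if "finite {n. r (n + k) \<in> acc}"
    for r :: "nat \<Rightarrow> 's" and k
  proof -
    have "{n. r n \<in> acc} \<subseteq> {..<k} \<union> (\<lambda>n. n + k) ` {n. r (n + k) \<in> acc}"
    proof
      fix n assume n: "n \<in> {n. r n \<in> acc}"
      show "n \<in> {..<k} \<union> (\<lambda>n. n + k) ` {n. r (n + k) \<in> acc}"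
      proof (cases "n < k")
        case False
        then have "n = (n - k) + k" by simp
        with n show ?thesis by (metis (mono_tags, lifting) UnCI imageI mem_Collect_eq)
      qed simp
    qed
    then show ?thesis using that by (auto intro: finite_subset)
  qed
  have \<G>I: "g \<in> \<G>" if "single_valued g" "\<And>s a b. (s, a) \<in> g \<Longrightarrow> succ s a b \<in> Domain g"
      "\<And>r. run g r \<Longrightarrow> finite {n. r n \<in> acc}" for g
    unfolding \<G>_def using that by simp
  have sv: "single_valued g" if "g \<in> \<G>" for g
    using that unfolding \<G>_def by simp
  have closed: "succ s a b \<in> Domain g" if "g \<in> \<G>" "(s, a) \<in> g" for g s a b
    using that unfolding \<G>_def by simp
  have fin_acc: "finite {n. r n \<in> acc}" if "g \<in> \<G>" "run g r" for g r
    using that unfolding \<G>_def by simp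
  have restrict: "run g (\<lambda>n. r (n + k))"
    if "g \<in> \<G>" "run g' r" "single_valued g'" "g \<subseteq> g'" "r k \<in> Domain g" for g g' r k
  proof -
    have tr: "(s, a) \<in> g" if "s \<in> Domain g" "(s, a) \<in> g'" for s a
      using that \<open>single_valued g'\<close> \<open>g \<subseteq> g'\<close> unfolding single_valued_def by blast
    have D: "r (n + k) \<in> Domain g" for n
    proof (induction n)
      case (Suc n)
      obtain a b where ab: "(r (n + k), a) \<in> g'" "r (Suc (n + k)) = succ (r (n + k)) a b"
        using \<open>run g' r\<close> unfolding run_def by blast
      with closed[OF \<open>g \<in> \<G>\<close> tr[OF Suc ab(1)]] show ?case by simp
    qed (use that in simp)
    show ?thesis
      using tr[OF D] \<open>run g' r\<close> unfolding run_def by (metis add_Suc)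
  qed
  \<comment> \<open>A run of the union starts in the domain of some member. As this member is closed
    under replies and the union is single-valued, the whole run belongs to that member.\<close>
  have "\<Union>C \<in> \<G>" if C: "subset.chain \<G> C" for C
  proof -
    have sub: "C \<subseteq> \<G>" and tot: "\<And>g h. g \<in> C \<Longrightarrow> h \<in> C \<Longrightarrow> g \<subseteq> h \<or> h \<subseteq> g"
      using C by (auto simp: subset_chain_def)
    have svC: "single_valued (\<Union>C)"
    proof (rule single_valuedI)
      fix x y z assume "(x, y) \<in> \<Union>C" "(x, z) \<in> \<Union>C"
      then obtain g h where "g \<in> C" "h \<in> C" "(x, y) \<in> g" "(x, z) \<in> h" by blast
      moreover have "single_valued g" "single_valued h"
        using calculation sub sv by blast+
      ultimately show "y = z"
        using tot[of g h] unfolding single_valued_def by blast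
    qed
    have "succ s a b \<in> Domain (\<Union>C)" if "(s, a) \<in> \<Union>C" for s a b
    proof -
      from that obtain g where g: "g \<in> C" "(s, a) \<in> g" by blast
      then have "succ s a b \<in> Domain g" using sub closed by blast
      then show ?thesis using g by blast
    qed
    moreover have "finite {n. r n \<in> acc}" if r: "run (\<Union>C) r" for r
    proof -
      obtain a where "(r 0, a) \<in> \<Union>C" using r unfolding run_def by blast
      then obtain g where g: "g \<in> C" "(r 0, a) \<in> g" by blast
      then have "run g (\<lambda>n. r (n + 0))"
        using sub svC r by (intro restrict[of g "\<Union>C" r 0]) auto
      then show ?thesis using fin_acc[of g] g sub by auto
    qed
    ultimately show ?thesis using svC by (intro \<G>I)
  qed
  then obtain g where g: "g \<in> \<G>" and max: "\<And>h. h \<in> \<G> \<Longrightarrow> g \<subseteq> h \<Longrightarrow> h = g"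
    using subset_Zorn'[of \<G>] by blast
  define A where "A = recur succ acc (- Domain g)"
  \<comment> \<open>A state outside \<open>A\<close> that lies in \<open>acc\<close> is not in the
    controllable predecessor of \<open>- Domain g\<close>, so some action forces entry into
    \<open>Domain g\<close>. A state outside both \<open>A\<close> and \<open>acc\<close> is not in
    \<open>cpre succ A\<close>, so some action keeps the play out of \<open>A\<close>.\<close>
  have "\<exists>a. \<forall>b. if s \<in> acc then succ s a b \<in> Domain g else succ s a b \<notin> A" if "s \<notin> A" for s
  proof (cases "s \<in> acc")
    case True
    have "s \<notin> reach succ acc (- Domain g) 0"
      using that unfolding A_def recur_def by blast
    then show ?thesis using True by (auto simp: cpre_def)
  next
    case False
    have "s \<notin> cpre succ A"
      using that cpre_recur[OF fin, of succ acc "- Domain g"] unfolding A_def by blast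
    then show ?thesis using False by (auto simp: cpre_def)
  qed
  then obtain \<alpha> where \<alpha>: "\<And>s b. s \<notin> A \<Longrightarrow>
      if s \<in> acc then succ s (\<alpha> s) b \<in> Domain g else succ s (\<alpha> s) b \<notin> A"
    by metis
  define h where "h = g \<union> {(s, \<alpha> s) |s. s \<notin> Domain g \<and> s \<notin> A}"
  have Dh: "Domain h = Domain g \<union> - A" unfolding h_def by auto
  have svh: "single_valued h"
    using sv[OF g] by (auto simp: h_def single_valued_def)
  have "h \<in> \<G>"
  proof -
    have "succ s a b \<in> Domain h" if "(s, a) \<in> h" for s a b
    proof (cases "(s, a) \<in> g")
      case True
      then show ?thesis using closed[OF g] by (auto simp: Dh)
    next
      case False
      then have "s \<notin> A" "a = \<alpha> s" using that by (auto simp: h_def)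
      then show ?thesis using \<alpha>[of s b] by (auto simp: Dh split: if_splits)
    qed
    \<comment> \<open>Once a run of \<open>h\<close> meets \<open>Domain g\<close>, its tail is a
      run of \<open>g\<close>. A run that never does cannot visit \<open>acc\<close>, since from
      there the next state would lie in \<open>Domain g\<close>.\<close>
    moreover have "finite {n. r n \<in> acc}" if r: "run h r" for r
    proof (cases "\<exists>k. r k \<in> Domain g")
      case True
      then obtain k where "r k \<in> Domain g" ..
      then have "run g (\<lambda>n. r (n + k))"
        using g r svh by (intro restrict[of g h]) (auto simp: h_def)
      then show ?thesis by (intro suffix[of r k] fin_acc[OF g])
    next
      case False
      have "r n \<notin> acc" for n
      proof
        assume "r n \<in> acc"
        obtain a b where "(r n, a) \<in> h" "r (Suc n) = succ (r n) a b"
          using r unfolding run_def by blast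
        moreover have "(r n, a) \<notin> g" using False by blast
        ultimately have "r n \<notin> A" "r (Suc n) = succ (r n) (\<alpha> (r n)) b"
          by (auto simp: h_def)
        then show False using \<alpha>[of "r n" b] \<open>r n \<in> acc\<close> False by metis
      qed
      then show ?thesis by simp
    qed
    ultimately show ?thesis using svh by (intro \<G>I)
  qed
  \<comment> \<open>Maximality leaves nothing to add, so \<open>- Domain g\<close> is contained in
    its own image under \<open>recur succ acc\<close>. A post-fixed point lies below the greatest
    fixed point.\<close>
  then have "h = g" by (rule max) (auto simp: h_def)
  then have "- Domain g \<subseteq> A" using Dh by auto
  then have sub: "- Domain g \<subseteq> gfp (recur succ acc)"
    unfolding A_def by (rule gfp_upperbound)
  define \<alpha>' where "\<alpha>' s = (SOME a. (s, a) \<in> g)" for s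
  have \<alpha>': "(s, \<alpha>' s) \<in> g" if "s \<in> Domain g" for s
    unfolding \<alpha>'_def using that by (auto intro: someI)
  have win: "finite {n. r n \<in> acc}"
    if r0: "r 0 \<notin> gfp (recur succ acc)" and r: "\<forall>n. \<exists>b. r (Suc n) = succ (r n) (\<alpha>' (r n)) b" for r
  proof -
    have "r n \<in> Domain g" for n
    proof (induction n)
      case 0
      then show ?case using r0 sub by blast
    next
      case (Suc n)
      obtain b where "r (Suc n) = succ (r n) (\<alpha>' (r n)) b" using r by blast
      with closed[OF g \<alpha>'[OF Suc]] show ?case by simp
    qed
    then have "run g r" unfolding run_def using \<alpha>' r by blast
    then show ?thesis by (rule fin_acc[OF g])
  qed
  show ?thesis
  proof (rule exI[of _ \<alpha>'], rule allI, rule impI, rule impI)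
    fix r assume "r 0 \<notin> gfp (recur succ acc)" "\<forall>n. \<exists>b. r (Suc n) = succ (r n) (\<alpha>' (r n)) b"
    then show "finite {n. r n \<in> acc}" by (rule win)
  qed
qed

text \<open>The greatest fixed point is an uncountable union of post-fixed points, so it need not be measurable. But a
  measurable superset of minimal probability is almost surely a post-fixed point.\<close>

lemma gfp_AE_measurable:
  fixes F :: "'w \<Rightarrow> 's::countable set \<Rightarrow> 's set"
  assumes "prob_space Q" and F: "\<And>\<omega>. mono (F \<omega>)"
    and meas: "\<And>X. (\<And>s. {\<omega> \<in> space Q. s \<in> X \<omega>} \<in> sets Q) \<Longrightarrow>
      (\<And>s. {\<omega> \<in> space Q. s \<in> F \<omega> (X \<omega>)} \<in> sets Q)"
  shows "\<exists>X. (\<forall>s. {\<omega> \<in> space Q. s \<in> X \<omega>} \<in> sets Q) \<and> (AE \<omega> in Q. X \<omega> = gfp (F \<omega>))"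
proof -
  interpret prob_space Q by fact
  define \<C> where "\<C> = {X. (\<forall>s. {\<omega> \<in> space Q. s \<in> X \<omega>} \<in> sets Q) \<and> (\<forall>\<omega>. gfp (F \<omega>) \<subseteq> X \<omega>)}"
  define m where "m X s = prob {\<omega> \<in> space Q. s \<in> X \<omega>}" for X :: "'w \<Rightarrow> 's set" and s
  have "(\<lambda>_. UNIV) \<in> \<C>" by (auto simp: \<C>_def)
  then have ne: "\<C> \<noteq> {}" by blast
  have bdd: "bdd_below ((\<lambda>X. m X s) ` \<C>)" for s
    by (rule bdd_belowI[of _ 0]) (auto simp: m_def)
  have "\<exists>X\<in>\<C>. m X s < (INF X\<in>\<C>. m X s) + 1 / real (Suc k)" for s k
    using cINF_less_iff[OF ne bdd, of s "(INF X\<in>\<C>. m X s) + 1 / real (Suc k)"] by auto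
  then obtain Y where Y: "\<And>s k. Y s k \<in> \<C>"
      "\<And>s k. m (Y s k) s < (INF X\<in>\<C>. m X s) + 1 / real (Suc k)"
    by metis
  \<comment> \<open>\<open>Y s k\<close> is within \<open>1 / (k + 1)\<close> of the infimum for the
    state \<open>s\<close>. Since there are countably many states, one countable intersection
    attains the infimum for all of them at once.\<close>
  define Z where "Z \<omega> = (\<Inter>s k. Y s k \<omega>)" for \<omega>
  have Zm: "{\<omega> \<in> space Q. t \<in> Z \<omega>} \<in> sets Q" for t
  proof -
    have "{\<omega> \<in> space Q. \<forall>s k. t \<in> Y s k \<omega>} \<in> sets Q"
      using Y(1) by (intro sets.sets_Collect_countable_All) (auto simp: \<C>_def)
    then show ?thesis by (simp add: Z_def)
  qed
  then have Z: "Z \<in> \<C>" using Y(1) unfolding \<C>_def Z_def by blast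
  \<comment> \<open>\<open>Z'\<close> still contains the greatest fixed point and is measurable, so
    minimality of \<open>Z\<close> makes the inclusion of \<open>Z'\<close> in \<open>Z\<close> an
    almost sure equality, state by state.\<close>
  define Z' where "Z' \<omega> = F \<omega> (Z \<omega>) \<inter> Z \<omega>" for \<omega>
  have "gfp (F \<omega>) \<subseteq> F \<omega> (Z \<omega>)" for \<omega>
    using gfp_unfold[OF F, of \<omega>] monoD[OF F, of "gfp (F \<omega>)" "Z \<omega>" \<omega>] Z by (auto simp: \<C>_def)
  moreover have "{\<omega> \<in> space Q. s \<in> Z' \<omega>} \<in> sets Q" for s
  proof -
    have "{\<omega> \<in> space Q. s \<in> Z' \<omega>} = {\<omega> \<in> space Q. s \<in> F \<omega> (Z \<omega>)} \<inter> {\<omega> \<in> space Q. s \<in> Z \<omega>}"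
      by (auto simp: Z'_def)
    then show ?thesis using sets.Int[OF meas[of Z, OF Zm] Zm] by simp
  qed
  ultimately have Z': "Z' \<in> \<C>" using Z by (auto simp: \<C>_def Z'_def)
  have "AE \<omega> in Q. s \<in> Z \<omega> \<longrightarrow> s \<in> Z' \<omega>" for s
  proof -
    have "m Z s \<le> m (Y s k) s" for k
      unfolding m_def using Y(1)[of s k] by (intro finite_measure_mono) (auto simp: \<C>_def Z_def)
    then have "m Z s \<le> (INF X\<in>\<C>. m X s) + 1 / real (Suc k)" for k
      using Y(2)[of s k] by (meson less_imp_le order_trans)
    then have "m Z s \<le> (INF X\<in>\<C>. m X s) + 0"
      by (intro LIMSEQ_le_const[OF tendsto_add[OF tendsto_const LIMSEQ_Suc[OF lim_1_over_n]]]) auto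
    also have "\<dots> \<le> m Z' s" using cINF_lower[OF bdd Z'] by simp
    finally have "m Z s \<le> m Z' s" .
    moreover have "{\<omega> \<in> space Q. s \<in> Z \<omega> \<and> s \<notin> Z' \<omega>} =
        {\<omega> \<in> space Q. s \<in> Z \<omega>} - {\<omega> \<in> space Q. s \<in> Z' \<omega>}"
      by auto
    moreover have "{\<omega> \<in> space Q. s \<in> Z' \<omega>} \<subseteq> {\<omega> \<in> space Q. s \<in> Z \<omega>}"
      by (auto simp: Z'_def)
    ultimately have "prob {\<omega> \<in> space Q. s \<in> Z \<omega> \<and> s \<notin> Z' \<omega>} \<le> 0"
      using Z Z' by (simp add: finite_measure_Diff m_def \<C>_def)
    moreover have "{\<omega> \<in> space Q. s \<in> Z \<omega> \<and> s \<notin> Z' \<omega>} \<in> sets Q"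
      using Z Z' \<open>{\<omega> \<in> space Q. s \<in> Z \<omega> \<and> s \<notin> Z' \<omega>} = _\<close> by (simp add: \<C>_def sets.Diff)
    ultimately show ?thesis
      by (subst AE_iff_measurable[OF _ refl])
        (auto simp: emeasure_eq_measure measure_le_0_iff)
  qed
  then have "AE \<omega> in Q. \<forall>s. s \<in> Z \<omega> \<longrightarrow> s \<in> Z' \<omega>"
    by (simp add: AE_all_countable)
  then have "AE \<omega> in Q. Z \<omega> = gfp (F \<omega>)"
  proof eventually_elim
    case (elim \<omega>)
    then have "Z \<omega> \<subseteq> gfp (F \<omega>)" by (intro gfp_upperbound) (auto simp: Z'_def)
    then show ?case using Z by (auto simp: \<C>_def)
  qed
  then show ?thesis using Zm by blast
qed

section \<open>The value of the game for a fixed realization\<close>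

lemma move_conv:
  "move w a b = (fst w + (case b of L \<Rightarrow> - 1 | R \<Rightarrow> 1), snd w + (case a of T \<Rightarrow> 1 | B \<Rightarrow> - 1))"
  by (cases w; cases a; cases b) simp_all

lemma finite_action1: "finite (UNIV :: action1 set)"
proof -
  have "(UNIV :: action1 set) = {T, B}" by (auto intro: action1.exhaust)
  then show ?thesis by (metis finite.emptyI finite.insertI)
qed

lemma move_sites: "w \<in> sites \<Longrightarrow> move w a b \<in> sites"
  by (auto simp: sites_def move_conv split: action1.split action2.split)

lemma move_edge: "w \<in> sites \<Longrightarrow> {w, move w a b} \<in> edges"
proof -
  assume w: "w \<in> sites"
  have "site_dist w (move w a b) = sqrt 2"
    by (simp add: site_dist_def move_conv dist_prod_def dist_real_def split: action1.split action2.split)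
  then show ?thesis
    using w move_sites[OF w] unfolding edges_def by blast
qed

lemma play_sites: "z \<in> sites \<Longrightarrow> fst (play z \<sigma> \<tau> n) \<in> sites"
  by (induction n) (simp_all add: case_prod_beta Let_def move_sites)

lemma crossed_Suc:
  "crossed z \<sigma> \<tau> (Suc n) = (let (w, h) = play z \<sigma> \<tau> n in {w, move w (\<sigma> h) (reply (\<tau> h) (\<sigma> h))})"
  by (simp add: crossed_def case_prod_beta Let_def)

lemma crossed_edges: "z \<in> sites \<Longrightarrow> 1 \<le> m \<Longrightarrow> crossed z \<sigma> \<tau> m \<in> edges"
  by (cases m) (simp_all add: crossed_Suc case_prod_beta Let_def move_edge play_sites)

definition open_count :: "(edge \<Rightarrow> bool) \<Rightarrow> site \<Rightarrow> strategy1 \<Rightarrow> strategy2 \<Rightarrow> nat \<Rightarrow> nat" where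
  "open_count c z \<sigma> \<tau> n = (\<Sum>m = 1..n. of_bool (c (crossed z \<sigma> \<tau> m)))"

lemma open_count_Suc:
  "open_count c z \<sigma> \<tau> (Suc n) = open_count c z \<sigma> \<tau> n + of_bool (c (crossed z \<sigma> \<tau> (Suc n)))"
  by (simp add: open_count_def)

lemma open_count_le: "open_count c z \<sigma> \<tau> n \<le> n"
  by (induction n) (auto simp: open_count_Suc, simp add: open_count_def)

lemma payoff_conv: "payoff c z \<sigma> \<tau> = limsup (\<lambda>n. ereal (real (open_count c z \<sigma> \<tau> n) / real n))"
  by (simp add: payoff_def open_count_def)

lemma payoff_nonneg: "0 \<le> payoff c z \<sigma> \<tau>"
  unfolding payoff_conv by (intro le_Limsup) auto

lemma payoff_le_1: "payoff c z \<sigma> \<tau> \<le> 1"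
  unfolding payoff_conv
  by (intro Limsup_bounded always_eventually allI)
    (auto simp: divide_le_eq_1 open_count_le)

lemma payoff_cong:
  assumes "z \<in> sites" "\<And>e. e \<in> edges \<Longrightarrow> c e = c' e"
  shows "payoff c z = payoff c' z"
  using crossed_edges[OF assms(1)] assms(2) by (simp add: payoff_def fun_eq_iff)

text \<open>The history determines the position of the token, the number of stages and the number of open
  edges crossed, and these three data form the states of a recurrence game.\<close>

type_synonym state = "site \<times> nat \<times> nat"

text \<open>Histories record unoriented edges; following them from the starting site recovers the
  position.\<close>

definition other_end :: "edge \<Rightarrow> site \<Rightarrow> site" where
  "other_end e w = (THE u. e = {w, u})"

definition advance :: "(edge \<Rightarrow> bool) \<Rightarrow> state \<Rightarrow> action1 \<Rightarrow> action2 \<Rightarrow> state" where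
  "advance c = (\<lambda>(w, n, k) a b. (move w a b, Suc n, k + of_bool (c {w, move w a b})))"

definition state_of :: "(edge \<Rightarrow> bool) \<Rightarrow> site \<Rightarrow> history \<Rightarrow> state" where
  "state_of c z = foldl (\<lambda>(w, n, k) e. (other_end e w, Suc n, k + of_bool (c e))) (z, 0, 0)"

text \<open>The running average exceeds \<open>q\<close>, written without division so that the state
  at \<open>n = 0\<close> causes no trouble.\<close>

definition above :: "real \<Rightarrow> state set" where
  "above q = {(w, n, k). q * real n < real k}"

definition forcing :: "real \<Rightarrow> (edge \<Rightarrow> bool) \<Rightarrow> state set" where
  "forcing q c = gfp (recur (advance c) (above q))"

lemma other_end [simp]: "other_end {w, u} w = u"
  unfolding other_end_def by (rule the_equality) (auto simp: doubleton_eq_iff)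

lemma state_of_play:
  "state_of c z (snd (play z \<sigma> \<tau> n)) = (fst (play z \<sigma> \<tau> n), n, open_count c z \<sigma> \<tau> n)"
proof (induction n)
  case 0
  then show ?case by (simp add: state_of_def open_count_def)
next
  case (Suc n)
  then show ?case
    by (simp add: state_of_def case_prod_beta Let_def open_count_Suc crossed_Suc)
qed

lemma state_of_play_Suc:
  assumes "h = snd (play z \<sigma> \<tau> n)"
  shows "state_of c z (snd (play z \<sigma> \<tau> (Suc n))) =
    advance c (state_of c z h) (\<sigma> h) (reply (\<tau> h) (\<sigma> h))"
  unfolding assms state_of_play
  by (simp add: advance_def case_prod_beta Let_def open_count_Suc crossed_Suc)

lemma state_of_play_above:
  "state_of c z (snd (play z \<sigma> \<tau> n)) \<in> above q \<longleftrightarrow> q * real n < real (open_count c z \<sigma> \<tau> n)"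
  by (simp add: state_of_play above_def)

text \<open>A limsup below \<open>q\<close> would leave only finitely many averages above
  \<open>q\<close>. The strict inequality in \<open>above\<close> becomes a weak one in the limit,
  here and in the companion bound, so neither bound decides the case of payoff exactly
  \<open>q\<close>.\<close>

lemma payoff_ge_of_infinite:
  assumes "infinite {n. q * real n < real (open_count c z \<sigma> \<tau> n)}"
  shows "ereal q \<le> payoff c z \<sigma> \<tau>"
proof (rule ccontr)
  assume "\<not> ereal q \<le> payoff c z \<sigma> \<tau>"
  then have "payoff c z \<sigma> \<tau> < ereal q" by simp
  then have "\<forall>\<^sub>F n in sequentially. ereal (real (open_count c z \<sigma> \<tau> n) / real n) < ereal q"
    unfolding payoff_conv by (rule Limsup_lessD)
  with eventually_gt_at_top[of 0]
  have "\<forall>\<^sub>F n in sequentially. \<not> q * real n < real (open_count c z \<sigma> \<tau> n)"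
    by eventually_elim (auto simp: field_simps)
  then have "finite {n. q * real n < real (open_count c z \<sigma> \<tau> n)}"
    using MOST_iff_cofinite by (auto simp flip: cofinite_eq_sequentially simp: eventually_cofinite)
  then show False using assms by simp
qed

lemma payoff_le_of_finite:
  assumes "finite {n. q * real n < real (open_count c z \<sigma> \<tau> n)}"
  shows "payoff c z \<sigma> \<tau> \<le> ereal q"
proof -
  have "\<forall>\<^sub>F n in sequentially. \<not> q * real n < real (open_count c z \<sigma> \<tau> n)"
    using assms by (simp flip: cofinite_eq_sequentially add: eventually_cofinite)
  with eventually_gt_at_top[of 0]
  have "\<forall>\<^sub>F n in sequentially. ereal (real (open_count c z \<sigma> \<tau> n) / real n) \<le> ereal q"
    by eventually_elim (auto simp: field_simps)
  then show ?thesis unfolding payoff_conv by (rule Limsup_bounded)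
qed

lemma maxmin_ge_of_forcing:
  assumes "(z, 0, 0) \<in> forcing q c"
  shows "ereal q \<le> (SUP \<tau>. INF \<sigma>. payoff c z \<sigma> \<tau>)"
proof -
  obtain \<beta> where \<beta>: "\<And>r. r 0 \<in> forcing q c \<Longrightarrow>
      (\<And>n. \<exists>a. r (Suc n) = advance c (r n) a (\<beta> (r n) a)) \<Longrightarrow> infinite {n. r n \<in> above q}"
    using recur_strategy[of "advance c" "above q"] unfolding forcing_def by blast
  \<comment> \<open>The positional strategy is read off the state that the history determines, once
    for each possible announcement.\<close>
  define \<tau> where "\<tau> h = (\<beta> (state_of c z h) T, \<beta> (state_of c z h) B)" for h
  have reply: "reply (\<tau> h) a = \<beta> (state_of c z h) a" for h a
    by (cases a) (simp_all add: \<tau>_def)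
  have "ereal q \<le> payoff c z \<sigma> \<tau>" for \<sigma>
  proof (rule payoff_ge_of_infinite)
    define r where "r n = state_of c z (snd (play z \<sigma> \<tau> n))" for n
    have "infinite {n. r n \<in> above q}"
    proof (rule \<beta>)
      show "r 0 \<in> forcing q c" using assms by (simp add: r_def state_of_def)
      show "\<exists>a. r (Suc n) = advance c (r n) a (\<beta> (r n) a)" for n
        unfolding r_def state_of_play_Suc[OF refl] reply by blast
    qed
    then show "infinite {n. q * real n < real (open_count c z \<sigma> \<tau> n)}"
      by (simp add: r_def state_of_play_above)
  qed
  then have "ereal q \<le> (INF \<sigma>. payoff c z \<sigma> \<tau>)" by (rule INF_greatest)
  then show ?thesis by (intro SUP_upper2[OF UNIV_I])
qed

lemma minmax_le_of_not_forcing: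
  assumes "(z, 0, 0) \<notin> forcing q c"
  shows "(INF \<sigma>. SUP \<tau>. payoff c z \<sigma> \<tau>) \<le> ereal q"
proof -
  obtain \<alpha> where \<alpha>: "\<And>r. r 0 \<notin> forcing q c \<Longrightarrow>
      (\<And>n. \<exists>b. r (Suc n) = advance c (r n) (\<alpha> (r n)) b) \<Longrightarrow> finite {n. r n \<in> above q}"
    using avoid_strategy[OF finite_action1, of "advance c" "above q"] unfolding forcing_def by blast
  define \<sigma> where "\<sigma> h = \<alpha> (state_of c z h)" for h
  have "payoff c z \<sigma> \<tau> \<le> ereal q" for \<tau>
  proof (rule payoff_le_of_finite)
    define r where "r n = state_of c z (snd (play z \<sigma> \<tau> n))" for n
    have "finite {n. r n \<in> above q}"
    proof (rule \<alpha>)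
      show "r 0 \<notin> forcing q c" using assms by (simp add: r_def state_of_def)
      show "\<exists>b. r (Suc n) = advance c (r n) (\<alpha> (r n)) b" for n
        unfolding r_def state_of_play_Suc[OF refl] unfolding \<sigma>_def by blast
    qed
    then show "finite {n. q * real n < real (open_count c z \<sigma> \<tau> n)}"
      by (simp add: r_def state_of_play_above)
  qed
  then have "(SUP \<tau>. payoff c z \<sigma> \<tau>) \<le> ereal q" by (rule SUP_least)
  then show ?thesis by (intro INF_lower2[OF UNIV_I])
qed

text \<open>The upper value, kept in the extended reals; \<open>val_maxmin\<close> identifies it
  with the lower value.\<close>

definition val :: "(edge \<Rightarrow> bool) \<Rightarrow> site \<Rightarrow> ereal" where
  "val c z = (INF \<sigma>. SUP \<tau>. payoff c z \<sigma> \<tau>)"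

text \<open>A threshold strictly inside a gap between the two values is impossible: the initial
  state either lies in \<open>forcing q c\<close>, which bounds the lower value from below, or does
  not, which bounds the upper value from above.\<close>

lemma val_maxmin: "val c z = (SUP \<tau>. INF \<sigma>. payoff c z \<sigma> \<tau>)"
proof (rule antisym)
  show "val c z \<le> (SUP \<tau>. INF \<sigma>. payoff c z \<sigma> \<tau>)"
  proof (rule ccontr)
    assume "\<not> ?thesis"
    then obtain q where "(SUP \<tau>. INF \<sigma>. payoff c z \<sigma> \<tau>) < ereal q" "ereal q < val c z"
      using ereal_dense2 by (auto simp: not_le)
    then show False
      using maxmin_ge_of_forcing[of z q c] minmax_le_of_not_forcing[of z q c]
      unfolding val_def by (meson not_le)
  qed
  show "(SUP \<tau>. INF \<sigma>. payoff c z \<sigma> \<tau>) \<le> val c z"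
    unfolding val_def
    by (intro SUP_least INF_greatest) (meson INF_lower SUP_upper UNIV_I order_trans)
qed

lemma ereal_dense_Rats:
  fixes x y :: ereal
  assumes "x < y"
  shows "\<exists>q\<in>\<rat>. x < ereal q \<and> ereal q < y"
  using ereal_dense3[OF assms] by (auto intro: bexI[of _ "of_rat _"])

text \<open>The intermediate \<open>q'\<close> absorbs the weak inequalities of the two guarantees.
  It is rational so that the event becomes a countable union.\<close>

lemma val_gt_iff_forcing:
  "ereal q < val c z \<longleftrightarrow> (\<exists>q'\<in>\<rat>. q < q' \<and> (z, 0, 0) \<in> forcing q' c)"
proof
  assume "ereal q < val c z"
  then obtain q' where q': "q' \<in> \<rat>" "q < q'" "ereal q' < val c z"
    using ereal_dense_Rats[of "ereal q" "val c z"] by auto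
  then have "(z, 0, 0) \<in> forcing q' c"
    using minmax_le_of_not_forcing[of z q' c] unfolding val_def by (meson not_le)
  then show "\<exists>q'\<in>\<rat>. q < q' \<and> (z, 0, 0) \<in> forcing q' c" using q' by blast
next
  assume "\<exists>q'\<in>\<rat>. q < q' \<and> (z, 0, 0) \<in> forcing q' c"
  then obtain q' where "q < q'" "ereal q' \<le> val c z"
    using maxmin_ge_of_forcing[of z _ c] unfolding val_maxmin by blast
  then show "ereal q < val c z" by (meson ereal_less_eq(3) le_less_trans not_le)
qed

lemma val_nonneg: "0 \<le> val c z"
  unfolding val_def by (intro INF_greatest SUP_upper2[OF UNIV_I] payoff_nonneg)

lemma val_le_1: "val c z \<le> 1"
  unfolding val_def by (intro INF_lower2[OF UNIV_I] SUP_least payoff_le_1)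

lemma val_cong:
  assumes "z \<in> sites" "\<And>e. e \<in> edges \<Longrightarrow> c e = c' e"
  shows "val c z = val c' z"
  using payoff_cong[of z c c'] assms unfolding val_def by simp

lemma is_game_value_iff: "is_game_value c z v \<longleftrightarrow> val c z = ereal v"
  unfolding is_game_value_def using val_maxmin[of c z] by (auto simp: val_def)

section \<open>Dependence of the value on the starting point\<close>

text \<open>The recursion of \<open>play\<close> peels off the last stage; this peels off the first
  one and passes to the continuation strategies.\<close>

lemma play_Suc_first:
  assumes "z' = move z (\<sigma> []) (reply (\<tau> []) (\<sigma> []))" and "e = {z, z'}"
  shows "play z \<sigma> \<tau> (Suc n) = apsnd ((#) e) (play z' (\<lambda>h. \<sigma> (e # h)) (\<lambda>h. \<tau> (e # h)) n)"
proof (induction n)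
  case 0
  then show ?case using assms by (simp add: Let_def)
next
  case (Suc n)
  show ?case
    by (subst play.simps(2), subst Suc) (simp add: case_prod_beta Let_def)
qed

text \<open>One stage changes the running average by at most \<open>1 / n\<close>, which vanishes in
  the limsup.\<close>

lemma payoff_first:
  assumes "z' = move z (\<sigma> []) (reply (\<tau> []) (\<sigma> []))" and "e = {z, z'}"
  shows "payoff c z \<sigma> \<tau> = payoff c z' (\<lambda>h. \<sigma> (e # h)) (\<lambda>h. \<tau> (e # h))"
proof -
  let ?\<sigma> = "\<lambda>h. \<sigma> (e # h)" and ?\<tau> = "\<lambda>h. \<tau> (e # h)"
  define N where "N = open_count c z \<sigma> \<tau>"
  define N' where "N' = open_count c z' ?\<sigma> ?\<tau>"
  have crossed: "crossed z \<sigma> \<tau> (Suc (Suc m)) = crossed z' ?\<sigma> ?\<tau> (Suc m)" for m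
    unfolding crossed_Suc play_Suc_first[of z' z \<sigma> \<tau>, OF assms] by (simp add: case_prod_beta Let_def)
  have N: "N (Suc n) = of_bool (c e) + N' n" for n
  proof (induction n)
    case 0
    then show ?case using assms by (simp add: N_def N'_def open_count_def crossed_Suc)
  next
    case (Suc n)
    then show ?case by (simp add: N_def N'_def open_count_Suc crossed)
  qed
  define d where "d n = real (N (Suc n)) / real (Suc n) - real (N' n) / real n" for n
  have "\<bar>d n\<bar> \<le> 1 / real n" if "n > 0" for n
  proof -
    have le: "real (N' n) \<le> real n"
      unfolding N'_def by (simp add: open_count_le)
    \<comment> \<open>The index offset leaves the denominator \<open>n * (n + 1)\<close>, while the
      numerator lies between \<open>- n\<close> and \<open>n\<close>.\<close>
    have "d n = (real (of_bool (c e)) * n - N' n) / (real n * real (Suc n))"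
      using that by (simp add: d_def N field_simps)
    moreover have "\<bar>real (of_bool (c e)) * n - N' n\<bar> \<le> real n"
      using le by (cases "c e") auto
    ultimately have "\<bar>d n\<bar> \<le> real n / \<bar>real n * real (Suc n)\<bar>"
      by (simp only: abs_divide divide_right_mono abs_ge_zero)
    also have "\<dots> = 1 / real (Suc n)" using that by simp
    also have "\<dots> \<le> 1 / real n" using that by (intro divide_left_mono) auto
    finally show ?thesis .
  qed
  then have "d \<longlonglongrightarrow> 0"
    by (intro Lim_null_comparison[OF _ lim_1_over_n] eventually_sequentiallyI[of 1]) auto
  then have "(\<lambda>n. ereal (d n)) \<longlonglongrightarrow> 0" by (simp add: zero_ereal_def)
  have "payoff c z \<sigma> \<tau> = limsup (\<lambda>n. ereal (real (N (n + 1)) / real (n + 1)))"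
    unfolding payoff_conv N_def by (rule limsup_shift[symmetric])
  also have "\<dots> = limsup (\<lambda>n. ereal (d n) + ereal (real (N' n) / real n))"
    by (simp add: d_def)
  also have "\<dots> = 0 + limsup (\<lambda>n. ereal (real (N' n) / real n))"
    using \<open>(\<lambda>n. ereal (d n)) \<longlonglongrightarrow> 0\<close> by (rule ereal_limsup_lim_add) simp
  finally show ?thesis by (simp add: payoff_conv N'_def)
qed

text \<open>A strategy guaranteeing more than \<open>q\<close> from \<open>z\<close> already
  contains a reply to \<open>a\<close>, and its continuation guarantees as much from the next site.
  So the second player can stay in \<open>{v > q}\<close> whatever is announced.\<close>

lemma val_gt_step:
  assumes "q < val c z"
  shows "\<exists>b. q < val c (move z a b)"
proof -
  obtain \<tau> where \<tau>: "q < (INF \<sigma>. payoff c z \<sigma> \<tau>)"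
    using assms unfolding val_maxmin less_SUP_iff by blast
  define z' where "z' = move z a (reply (\<tau> []) a)"
  define e where "e = {z, z'}"
  have "(INF \<sigma>. payoff c z \<sigma> \<tau>) \<le> (INF \<sigma>. payoff c z' \<sigma> (\<lambda>h. \<tau> (e # h)))"
  proof (rule INF_greatest)
    fix \<sigma>
    \<comment> \<open>Play \<open>a\<close> first and then follow \<open>\<sigma>\<close> with the
      first edge dropped from the history.\<close>
    define \<sigma>' where "\<sigma>' h = (case h of [] \<Rightarrow> a | _ # h' \<Rightarrow> \<sigma> h')" for h :: history
    have "payoff c z \<sigma>' \<tau> = payoff c z' \<sigma> (\<lambda>h. \<tau> (e # h))"
      using payoff_first[of z' z \<sigma>' \<tau> e c] by (simp add: \<sigma>'_def z'_def e_def)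
    then show "(INF \<sigma>. payoff c z \<sigma> \<tau>) \<le> payoff c z' \<sigma> (\<lambda>h. \<tau> (e # h))"
      by (metis INF_lower UNIV_I)
  qed
  also have "\<dots> \<le> val c z'"
    unfolding val_maxmin by (rule SUP_upper) simp
  finally show ?thesis using \<tau> unfolding z'_def by (meson less_le_trans)
qed

lemma val_less_step:
  assumes "val c z < q"
  shows "\<exists>a. \<forall>b. val c (move z a b) < q"
proof -
  obtain \<sigma> where \<sigma>: "(SUP \<tau>. payoff c z \<sigma> \<tau>) < q"
    using assms unfolding val_def INF_less_iff by blast
  have "val c (move z (\<sigma> []) b) < q" for b
  proof -
    define z' where "z' = move z (\<sigma> []) b"
    define e where "e = {z, z'}"
    have "val c z' \<le> (SUP \<tau>. payoff c z' (\<lambda>h. \<sigma> (e # h)) \<tau>)"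
      unfolding val_def by (rule INF_lower) simp
    also have "\<dots> \<le> (SUP \<tau>. payoff c z \<sigma> \<tau>)"
    proof (rule SUP_least)
      fix \<tau>
      \<comment> \<open>The constant pair yields the reply \<open>b\<close> to whichever action
        \<open>\<sigma>\<close> announces first.\<close>
      define \<tau>' where "\<tau>' h = (case h of [] \<Rightarrow> (b, b) | _ # h' \<Rightarrow> \<tau> h')" for h :: history
      have "reply (b, b) a = b" for a by (cases a) simp_all
      then have "payoff c z \<sigma> \<tau>' = payoff c z' (\<lambda>h. \<sigma> (e # h)) \<tau>"
        using payoff_first[of z' z \<sigma> \<tau>' e c] by (simp add: \<tau>'_def z'_def e_def)
      then show "payoff c z' (\<lambda>h. \<sigma> (e # h)) \<tau> \<le> (SUP \<tau>. payoff c z \<sigma> \<tau>)"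
        by (metis SUP_upper UNIV_I)
    qed
    finally show ?thesis using \<sigma> unfolding z'_def by (meson le_less_trans)
  qed
  then show ?thesis by blast
qed

section \<open>Translation of the lattice and of the game\<close>

definition shift :: "site \<Rightarrow> edge \<Rightarrow> edge" where
  "shift d e = (\<lambda>v. v + d) ` e"

lemma shift_shift: "shift d (shift d' e) = shift (d' + d) e"
  by (simp add: shift_def image_image add.assoc)

lemma shift_0 [simp]: "shift 0 e = e"
  by (simp add: shift_def)

lemma move_shift: "move (w + d) a b = move w a b + d"
  by (simp add: move_conv prod_eq_iff)

lemma play_shift:
  "play (z + d) \<sigma> \<tau> n = map_prod (\<lambda>v. v + d) (map (shift d))
     (play z (\<lambda>h. \<sigma> (map (shift d) h)) (\<lambda>h. \<tau> (map (shift d) h)) n)"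
  by (induction n) (simp_all add: case_prod_beta Let_def move_shift shift_def)

lemma payoff_shift:
  "payoff c (z + d) \<sigma> \<tau> = payoff (\<lambda>e. c (shift d e)) z
     (\<lambda>h. \<sigma> (map (shift d) h)) (\<lambda>h. \<tau> (map (shift d) h))"
proof -
  have "crossed (z + d) \<sigma> \<tau> m = shift d
      (crossed z (\<lambda>h. \<sigma> (map (shift d) h)) (\<lambda>h. \<tau> (map (shift d) h)) m)" for m
    by (simp add: crossed_def play_shift shift_def)
  then show ?thesis by (simp add: payoff_def)
qed

text \<open>Relabelling histories permutes the strategies, so the infimum and the supremum in the
  value are unaffected by it.\<close>

lemma surj_comp_shift: "surj (\<lambda>f h. f (map (shift d) h))"
  by (rule surjI[where f = "\<lambda>f h. f (map (shift (- d)) h)"]) (simp add: shift_shift o_def)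

lemma val_shift: "val c (z + d) = val (\<lambda>e. c (shift d e)) z"
proof -
  let ?c = "\<lambda>e. c (shift d e)"
  have "val c (z + d) = (INF \<sigma>\<in>range (\<lambda>f h. f (map (shift d) h)).
      SUP \<tau>\<in>range (\<lambda>f h. f (map (shift d) h)). payoff ?c z \<sigma> \<tau>)"
    by (simp add: val_def payoff_shift image_image)
  then show ?thesis unfolding surj_comp_shift val_def .
qed

section \<open>Diagonal rays\<close>

text \<open>Dependent choice. The increment \<open>e\<close> is a parameter to serve both
  directions; with exchanged coordinates the same statement gives vertical paths.\<close>

lemma lattice_path:
  fixes S :: "(int \<times> int) set"
  assumes "(x0, y0) \<in> S" and step: "\<And>x y. (x, y) \<in> S \<Longrightarrow> \<exists>y'. (x + e, y') \<in> S \<and> \<bar>y' - y\<bar> = 1"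
  shows "\<exists>f. f 0 = y0 \<and> (\<forall>n. (x0 + e * int n, f n) \<in> S \<and> \<bar>f (Suc n) - f n\<bar> = 1)"
proof -
  have "\<exists>f. \<forall>n. ((x0 + e * int n, f n) \<in> S \<and> (n = 0 \<longrightarrow> f n = y0)) \<and> \<bar>f (Suc n) - f n\<bar> = 1"
  proof (rule dependent_nat_choice)
    show "\<exists>y. (x0 + e * int 0, y) \<in> S \<and> (0 = (0::nat) \<longrightarrow> y = y0)"
      using assms(1) by auto
  next
    fix y and n :: nat
    assume "(x0 + e * int n, y) \<in> S \<and> (n = 0 \<longrightarrow> y = y0)"
    then obtain y' where "(x0 + e * int n + e, y') \<in> S" "\<bar>y' - y\<bar> = 1" using step by blast
    moreover have "x0 + e * int n + e = x0 + e * int (Suc n)" by (simp add: algebra_simps)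
    ultimately show "\<exists>y'. ((x0 + e * int (Suc n), y') \<in> S \<and> (Suc n = 0 \<longrightarrow> y' = y0)) \<and> \<bar>y' - y\<bar> = 1"
      by auto
  qed
  then show ?thesis by blast
qed

lemma bi_infinite_lattice_path:
  fixes S :: "(int \<times> int) set"
  assumes z: "(x0, y0) \<in> S"
    and step: "\<And>x y e. (x, y) \<in> S \<Longrightarrow> \<bar>e\<bar> = 1 \<Longrightarrow> \<exists>y'. (x + e, y') \<in> S \<and> \<bar>y' - y\<bar> = 1"
  shows "\<exists>g. \<forall>x. (x, g x) \<in> S \<and> \<bar>g (x + 1) - g x\<bar> = 1"
proof -
  obtain f where f: "f 0 = y0" "\<And>n. (x0 + int n, f n) \<in> S" "\<And>n. \<bar>f (Suc n) - f n\<bar> = 1"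
    using lattice_path[OF z step, where e = 1] by auto
  obtain h where h: "h 0 = y0" "\<And>n. (x0 - int n, h n) \<in> S" "\<And>n. \<bar>h (Suc n) - h n\<bar> = 1"
    using lattice_path[OF z step, where e = "- 1"] by auto
  define g where "g x = (if x0 \<le> x then f (nat (x - x0)) else h (nat (x0 - x)))" for x
  have "(x, g x) \<in> S" for x
    using f(2)[of "nat (x - x0)"] h(2)[of "nat (x0 - x)"] by (auto simp: g_def)
  moreover have "\<bar>g (x + 1) - g x\<bar> = 1" for x
  proof (cases "x0 \<le> x")
    case True
    then have "nat (x + 1 - x0) = Suc (nat (x - x0))" by simp
    then show ?thesis using f(3)[of "nat (x - x0)"] True by (simp add: g_def)
  next
    case False
    then have "g (x + 1) = h (nat (x0 - (x + 1)))"
      using f(1) h(1) by (cases "x + 1 = x0") (auto simp: g_def)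
    moreover have "nat (x0 - x) = Suc (nat (x0 - (x + 1)))" using False by simp
    ultimately show ?thesis
      using h(3)[of "nat (x0 - (x + 1))"] False by (simp add: g_def abs_minus_commute)
  qed
  ultimately show ?thesis by blast
qed

text \<open>A site of \<open>A\<close> starts a vertical path in \<open>A\<close> towards the horizontal path \<open>y = g x\<close>. Their
  signed height difference never increases, and it cannot vanish, so it is eventually constant. From then
  on the vertical path cannot turn.\<close>

lemma vertical_path_eventually_diagonal:
  fixes A :: "site set" and g :: "int \<Rightarrow> int"
  assumes A: "\<And>x y. (x, y) \<in> A \<Longrightarrow> \<exists>x'. (x', y - s) \<in> A \<and> \<bar>x' - x\<bar> = 1"
    and "A \<subseteq> sites" and g: "\<And>x. (x, g x) \<in> sites - A" "\<And>x. \<bar>g (x + 1) - g x\<bar> = 1"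
    and s: "\<bar>s\<bar> = 1" and z: "(x0, y0) \<in> A" "0 < s * (y0 - g x0)"
  shows "\<exists>z\<in>A. \<exists>t. \<bar>t\<bar> = 1 \<and> (\<forall>k. (fst z + t * int k, snd z - s * int k) \<in> A)"
proof -
  have "\<exists>f. f 0 = x0 \<and> (\<forall>n. (y0 + (- s) * int n, f n) \<in> {(y, x). (x, y) \<in> A} \<and> \<bar>f (Suc n) - f n\<bar> = 1)"
    using z(1) A by (intro lattice_path) auto
  then obtain f where f: "f 0 = x0" "\<And>n. (f n, y0 - s * int n) \<in> A" "\<And>n. \<bar>f (Suc n) - f n\<bar> = 1"
    by auto
  have gf: "\<bar>g (f (Suc n)) - g (f n)\<bar> = 1" for n
  proof -
    have "f (Suc n) = f n + 1 \<or> f n = f (Suc n) + 1" using f(3)[of n] by linarith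
    then show ?thesis using g(2)[of "f n"] g(2)[of "f (Suc n)"] by (auto simp: abs_minus_commute)
  qed
  have ss: "s = 1 \<or> s = - 1" using s by linarith
  define h where "h n = s * (y0 - s * int n - g (f n))" for n
  have h_Suc: "h (Suc n) = h n - 1 - s * (g (f (Suc n)) - g (f n))" for n
    using ss by (auto simp: h_def algebra_simps)
  have h_step: "h (Suc n) = h n \<or> h (Suc n) = h n - 2" for n
  proof -
    have "s * (g (f (Suc n)) - g (f n)) = 1 \<or> s * (g (f (Suc n)) - g (f n)) = - 1"
      using gf[of n] ss by auto
    then show ?thesis using h_Suc[of n] by auto
  qed
  \<comment> \<open>Both points lie on the lattice, so \<open>h\<close> is even and a drop by 2
    cannot jump over 0. It cannot hit 0 either, since the horizontal path avoids
    \<open>A\<close>.\<close>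
  have h_pos: "0 < h n" for n
  proof (induction n)
    case 0
    then show ?case using z(2) f(1) by (simp add: h_def)
  next
    case (Suc n)
    have "even (f (Suc n) + (y0 - s * int (Suc n)))" "even (f (Suc n) + g (f (Suc n)))"
      using f(2)[of "Suc n"] g(1)[of "f (Suc n)"] \<open>A \<subseteq> sites\<close> by (auto simp: sites_def)
    then have "even (h (Suc n))" unfolding h_def by (simp add: even_mult_iff)
    moreover have "h (Suc n) \<noteq> 0"
      using f(2)[of "Suc n"] g(1)[of "f (Suc n)"] ss by (auto simp: h_def)
    ultimately show ?case using Suc h_step[of n] by presburger
  qed
  have antimono: "h m \<le> h n" if "n \<le> m" for m n
  proof (rule lift_Suc_antimono_le[OF _ that])
    show "h (Suc n) \<le> h n" for n using h_step[of n] by auto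
  qed
  obtain N where N: "\<And>n. nat (h N) \<le> nat (h n)"
    using ex_has_least_nat[of "\<lambda>_. True" _ "\<lambda>n. nat (h n)"] by auto
  have const: "h n = h N" if "N \<le> n" for n
    using N[of n] h_pos[of n] antimono[OF that] by linarith
  have drop: "g (f (Suc n)) = g (f n) - s" if "N \<le> n" for n
    using h_Suc[of n] const[of n] const[of "Suc n"] that ss by auto
  \<comment> \<open>Past \<open>N\<close> the horizontal path descends by \<open>s\<close> at every
    step of \<open>f\<close>. Turning back would revisit a column where \<open>g\<close> has already
    taken another value.\<close>
  have straight: "f (Suc (Suc n)) - f (Suc n) = f (Suc n) - f n" if "N \<le> n" for n
  proof -
    have "g (f (Suc (Suc n))) \<noteq> g (f n)" using drop[of n] drop[of "Suc n"] that ss by auto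
    then have "f (Suc (Suc n)) \<noteq> f n" by metis
    then show ?thesis using f(3)[of n] f(3)[of "Suc n"] by linarith
  qed
  define t where "t = f (Suc N) - f N"
  have slope: "f (Suc (N + k)) - f (N + k) = t" for k
    by (induction k) (use straight in \<open>auto simp: t_def\<close>)
  have ray: "f (N + k) = f N + t * int k" for k
  proof (induction k)
    case (Suc k)
    then show ?case using slope[of k] by (simp add: algebra_simps)
  qed simp
  have "\<forall>k. (f N + t * int k, y0 - s * int N - s * int k) \<in> A"
  proof
    fix k
    have "(f (N + k), y0 - s * int (N + k)) \<in> A" by (rule f(2))
    then show "(f N + t * int k, y0 - s * int N - s * int k) \<in> A"
      by (simp add: ray algebra_simps)
  qed
  moreover have "\<bar>t\<bar> = 1" using f(3) by (simp add: t_def)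
  ultimately show ?thesis using f(2)[of N] by (intro bexI[of _ "(f N, y0 - s * int N)"]) auto
qed

text \<open>The announced action fixes the vertical direction and the reply the horizontal one.
  Hence \<open>A\<close> can be followed up or down at will, while \<open>C\<close> can be followed
  left or right at will.\<close>

lemma diagonal_ray:
  assumes A: "\<And>z a. z \<in> A \<Longrightarrow> \<exists>b. move z a b \<in> A" and C: "\<And>z. z \<in> C \<Longrightarrow> \<exists>a. \<forall>b. move z a b \<in> C"
    and "A \<subseteq> sites" "C \<subseteq> sites" "A \<inter> C = {}" "A \<noteq> {}" "C \<noteq> {}"
  shows "\<exists>z\<in>A. \<exists>s t. \<bar>s\<bar> = 1 \<and> \<bar>t\<bar> = 1 \<and> (\<forall>k. z + (s * int k, t * int k) \<in> A)"
proof -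
  have A': "\<exists>x'. (x', y - s) \<in> A \<and> \<bar>x' - x\<bar> = 1" if xy: "(x, y) \<in> A" and "\<bar>s\<bar> = 1" for x y s
  proof -
    obtain b where "move (x, y) (if s = 1 then B else T) b \<in> A" using A[OF xy] by blast
    moreover have "s = 1 \<or> s = - 1" using that(2) by linarith
    ultimately show ?thesis
      by (intro exI[of _ "x + (case b of L \<Rightarrow> - 1 | R \<Rightarrow> 1)"])
        (auto simp: move_conv split: if_splits action2.splits)
  qed
  have C': "\<exists>y'. (x + e, y') \<in> C \<and> \<bar>y' - y\<bar> = 1" if xy: "(x, y) \<in> C" and "\<bar>e\<bar> = 1" for x y e
  proof -
    obtain a where "move (x, y) a (if e = 1 then R else L) \<in> C" using C[OF xy] by blast
    moreover have "e = 1 \<or> e = - 1" using that(2) by linarith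
    ultimately show ?thesis
      by (intro exI[of _ "y + (case a of T \<Rightarrow> 1 | B \<Rightarrow> - 1)"])
        (auto simp: move_conv split: if_splits action1.splits)
  qed
  obtain x0 y0 where z: "(x0, y0) \<in> A" using \<open>A \<noteq> {}\<close> by auto
  obtain x1 y1 where "(x1, y1) \<in> C" using \<open>C \<noteq> {}\<close> by auto
  then obtain g where g: "\<And>x. (x, g x) \<in> C" "\<And>x. \<bar>g (x + 1) - g x\<bar> = 1"
    using bi_infinite_lattice_path[OF _ C'] by metis
  have "y0 \<noteq> g x0" using z g(1)[of x0] \<open>A \<inter> C = {}\<close> by auto
  \<comment> \<open>The sign records the side of the horizontal path on which the site of
    \<open>A\<close> lies; the vertical path then runs towards it.\<close>
  define s where "s = sgn (y0 - g x0)"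
  have s: "\<bar>s\<bar> = 1" "0 < s * (y0 - g x0)"
    using \<open>y0 \<noteq> g x0\<close> by (auto simp: s_def sgn_if)
  have "(x, g x) \<in> sites - A" for x
    using g(1)[of x] \<open>C \<subseteq> sites\<close> \<open>A \<inter> C = {}\<close> by blast
  then obtain z t where "z \<in> A" "\<bar>t\<bar> = 1" "\<forall>k. (fst z + t * int k, snd z - s * int k) \<in> A"
    using vertical_path_eventually_diagonal[OF A'[OF _ s(1)] \<open>A \<subseteq> sites\<close> _ g(2) s(1) z s(2)] by blast
  then show ?thesis
    using s(1) by (intro bexI[of _ z] exI[of _ t] exI[of _ "- s"]) (auto simp: plus_prod_def)
qed

section \<open>Ergodicity of the translations\<close>

definition cost_space :: "real \<Rightarrow> (edge \<Rightarrow> bool) measure" where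
  "cost_space p = PiM edges (\<lambda>_. measure_pmf (bernoulli_pmf p))"

text \<open>The restriction to \<open>edges\<close> keeps the translated configuration in the
  product space, whose elements are \<open>undefined\<close> elsewhere.\<close>

definition translate :: "site \<Rightarrow> (edge \<Rightarrow> bool) \<Rightarrow> edge \<Rightarrow> bool" where
  "translate d \<omega> = (\<lambda>e\<in>edges. \<omega> (shift d e))"

interpretation bernoulli: product_prob_space "\<lambda>_::edge. measure_pmf (bernoulli_pmf p)" edges for p
  by (intro product_prob_spaceI prob_space_measure_pmf)

interpretation cost_space: prob_space "cost_space p" for p
  unfolding cost_space_def by (rule bernoulli.P.prob_space_axioms)

lemma space_cost_space: "space (cost_space p) = PiE edges (\<lambda>_. UNIV)"
  by (simp add: cost_space_def space_PiM)

lemma sites_add: "z \<in> sites \<Longrightarrow> d \<in> sites \<Longrightarrow> z + d \<in> sites"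
  by (auto simp: sites_def plus_prod_def)

lemma shift_edges:
  assumes d: "d \<in> sites" and "e \<in> edges"
  shows "shift d e \<in> edges"
proof -
  obtain u v where uv: "u \<in> sites" "v \<in> sites" "site_dist u v = sqrt 2" "e = {u, v}"
    using \<open>e \<in> edges\<close> unfolding edges_def by blast
  have "site_dist (u + d) (v + d) = sqrt 2"
    using uv(3) by (simp add: site_dist_def dist_Pair_Pair dist_real_def)
  moreover have "shift d e = {u + d, v + d}" by (simp add: shift_def uv(4))
  ultimately show ?thesis
    unfolding edges_def using sites_add[OF uv(1) d] sites_add[OF uv(2) d]
    by (intro CollectI exI[of _ "u + d"] exI[of _ "v + d"] conjI)
qed

lemma inj_shift: "inj (shift d)"
  by (rule inj_on_inverseI[of _ "shift (- d)"]) (simp add: shift_shift)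

lemma translate_translate:
  "d \<in> sites \<Longrightarrow> translate d (translate d' \<omega>) = translate (d + d') \<omega>"
  by (auto simp: translate_def shift_shift shift_edges fun_eq_iff restrict_def)

lemma measurable_translate [measurable]:
  assumes "d \<in> sites" shows "translate d \<in> measurable (cost_space p) (cost_space p)"
  unfolding cost_space_def translate_def
  by (intro measurable_restrict measurable_component_singleton shift_edges assms)

text \<open>Reindexing an i.i.d. product along an injection of the index set into itself preserves
  its law.\<close>

lemma distr_translate:
  assumes "d \<in> sites" shows "distr (cost_space p) (cost_space p) (translate d) = cost_space p"
proof -
  have "distr (PiM edges (\<lambda>_. measure_pmf (bernoulli_pmf p))) (PiM edges (\<lambda>_. measure_pmf (bernoulli_pmf p)))
      (\<lambda>\<omega>. \<lambda>e\<in>edges. \<omega> (shift d e)) = PiM edges (\<lambda>_. measure_pmf (bernoulli_pmf p))"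
    by (rule distr_PiM_reindex)
      (use inj_shift[of d] shift_edges[OF assms] in \<open>auto intro: inj_on_subset prob_space_measure_pmf\<close>)
  then show ?thesis by (simp add: cost_space_def translate_def[abs_def])
qed

lemma prob_translate:
  assumes "d \<in> sites" "G \<in> sets (cost_space p)"
  shows "cost_space.prob p (translate d -` G \<inter> space (cost_space p)) = cost_space.prob p G"
  using measure_distr[OF measurable_translate[OF assms(1)] assms(2)] distr_translate[OF assms(1), of p]
  by simp

lemma AE_translate:
  assumes "d \<in> sites" "AE \<omega> in cost_space p. P \<omega>"
  shows "AE \<omega> in cost_space p. P (translate d \<omega>)"
  using assms(2)
  by (intro AE_distrD[OF measurable_translate[OF assms(1)]]) (subst distr_translate[OF assms(1)])

section \<open>Cylinder events, mixing and the zero-one law\<close>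

definition cyl :: "real \<Rightarrow> edge set \<Rightarrow> (edge \<Rightarrow> bool set) \<Rightarrow> (edge \<Rightarrow> bool) set" where
  "cyl p J X = {\<omega> \<in> space (cost_space p). \<forall>e\<in>J. \<omega> e \<in> X e}"

lemma cyl_emb:
  assumes "J \<subseteq> edges"
  shows "prod_emb edges (\<lambda>_. measure_pmf (bernoulli_pmf p)) J (PiE J X) = cyl p J X"
  using assms by (auto simp: prod_emb_def cyl_def space_cost_space Pi_iff)

lemma prob_cyl:
  assumes "J \<subseteq> edges" "finite J"
  shows "cost_space.prob p (cyl p J X) = (\<Prod>e\<in>J. measure_pmf.prob (bernoulli_pmf p) (X e))"
  using bernoulli.measure_PiM_emb[OF assms, of X p] assms(1) by (simp add: cyl_emb cost_space_def)

lemma sets_cost_space: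
  "sets (cost_space p) = sigma_sets (space (cost_space p)) {cyl p J X |J X. finite J \<and> J \<subseteq> edges}"
proof -
  have "prod_algebra edges (\<lambda>_. measure_pmf (bernoulli_pmf p)) \<subseteq> {cyl p J X |J X. finite J \<and> J \<subseteq> edges}"
  proof
    fix A assume "A \<in> prod_algebra edges (\<lambda>_. measure_pmf (bernoulli_pmf p))"
    then obtain J X where "A = prod_emb edges (\<lambda>_. measure_pmf (bernoulli_pmf p)) J (PiE J X)" "finite J" "J \<subseteq> edges"
      by (rule prod_algebraE)
    then show "A \<in> {cyl p J X |J X. finite J \<and> J \<subseteq> edges}" by (auto simp: cyl_emb)
  qed
  then have "sets (cost_space p) \<subseteq> sigma_sets (space (cost_space p)) {cyl p J X |J X. finite J \<and> J \<subseteq> edges}"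
    unfolding cost_space_def sets_PiM space_PiM by (rule sigma_sets_mono')
  moreover have "{cyl p J X |J X. finite J \<and> J \<subseteq> edges} \<subseteq> sets (cost_space p)"
    by (auto simp: cost_space_def simp flip: cyl_emb intro!: sets_PiM_I)
  ultimately show ?thesis by (intro antisym sets.sigma_sets_subset)
qed

lemma cyl_sets: "finite J \<Longrightarrow> J \<subseteq> edges \<Longrightarrow> cyl p J X \<in> sets (cost_space p)"
  unfolding sets_cost_space by blast

lemma cyl_Int:
  "cyl p J X \<inter> cyl p K Y = cyl p (J \<union> K) (\<lambda>e. (if e \<in> J then X e else UNIV) \<inter> (if e \<in> K then Y e else UNIV))"
  by (auto simp: cyl_def)

lemma Int_stable_cyl: "Int_stable {cyl p J X |J X. finite J \<and> J \<subseteq> edges}"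
proof (rule Int_stableI)
  fix a b assume "a \<in> {cyl p J X |J X. finite J \<and> J \<subseteq> edges}" "b \<in> {cyl p J X |J X. finite J \<and> J \<subseteq> edges}"
  then obtain J X K Y where "a = cyl p J X" "b = cyl p K Y" "finite (J \<union> K)" "J \<union> K \<subseteq> edges"
    by auto
  then show "a \<inter> b \<in> {cyl p J X |J X. finite J \<and> J \<subseteq> edges}" using cyl_Int by blast
qed

lemma translate_cyl:
  assumes "d \<in> sites" "K \<subseteq> edges"
  shows "translate d -` cyl p K Y \<inter> space (cost_space p) = cyl p (shift d ` K) (\<lambda>e. Y (shift (- d) e))"
  using assms measurable_space[OF measurable_translate[OF assms(1)], of _ p]
  by (auto simp: cyl_def translate_def shift_shift subset_iff)

text \<open>If a shift sends \<open>k\<close> to \<open>j\<close>, then a fixed endpoint of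
  \<open>k\<close> lands in the finite set \<open>j\<close>. By injectivity of
  \<open>\<delta>\<close> this occurs for finitely many \<open>n\<close>.\<close>

lemma eventually_disjoint_shift:
  fixes \<delta> :: "nat \<Rightarrow> site"
  assumes "finite J" "finite K" "J \<subseteq> edges" "K \<subseteq> edges" "inj \<delta>"
  shows "\<forall>\<^sub>F n in sequentially. J \<inter> shift (\<delta> n) ` K = {}"
proof -
  have "finite {n. shift (\<delta> n) k = j}" if "j \<in> J" "k \<in> K" for j k
  proof -
    have edge: "\<exists>u v. e = {u, v}" if "e \<in> edges" for e
      using that unfolding edges_def by blast
    obtain v where v: "v \<in> k" using edge[of k] \<open>k \<in> K\<close> \<open>K \<subseteq> edges\<close> by blast
    have "finite j" using edge[of j] \<open>j \<in> J\<close> \<open>J \<subseteq> edges\<close> by force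
    moreover have "inj (\<lambda>n. v + \<delta> n)" using \<open>inj \<delta>\<close> by (auto simp: inj_on_def)
    ultimately have "finite ((\<lambda>n. v + \<delta> n) -` j)" by (rule finite_vimageI)
    moreover have "{n. shift (\<delta> n) k = j} \<subseteq> (\<lambda>n. v + \<delta> n) -` j" using v by (auto simp: shift_def)
    ultimately show ?thesis by (rule finite_subset[rotated])
  qed
  then have "finite (\<Union>j\<in>J. \<Union>k\<in>K. {n. shift (\<delta> n) k = j})"
    using assms by blast
  moreover have "{n. J \<inter> shift (\<delta> n) ` K \<noteq> {}} \<subseteq> (\<Union>j\<in>J. \<Union>k\<in>K. {n. shift (\<delta> n) k = j})"
    by auto
  ultimately have "finite {n. J \<inter> shift (\<delta> n) ` K \<noteq> {}}" by (rule finite_subset[rotated])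
  then show ?thesis by (simp flip: cofinite_eq_sequentially add: eventually_cofinite)
qed

lemma prob_cyl_Int_disjoint:
  assumes "finite J" "finite K" "J \<subseteq> edges" "K \<subseteq> edges" "J \<inter> K = {}"
  shows "cost_space.prob p (cyl p J X \<inter> cyl p K Y) =
    cost_space.prob p (cyl p J X) * cost_space.prob p (cyl p K Y)"
proof -
  let ?Z = "\<lambda>e. (if e \<in> J then X e else UNIV) \<inter> (if e \<in> K then Y e else UNIV)"
  have J: "(\<Prod>e\<in>J. measure_pmf.prob (bernoulli_pmf p) (?Z e)) = (\<Prod>e\<in>J. measure_pmf.prob (bernoulli_pmf p) (X e))"
    using assms(5) by (intro prod.cong) auto
  have K: "(\<Prod>e\<in>K. measure_pmf.prob (bernoulli_pmf p) (?Z e)) = (\<Prod>e\<in>K. measure_pmf.prob (bernoulli_pmf p) (Y e))"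
    using assms(5) by (intro prod.cong) auto
  show ?thesis
    unfolding cyl_Int using assms by (simp only: prob_cyl finite_UnI Un_least prod.union_disjoint J K)
qed

text \<open>Induction over the generated \<sigma>-algebra. For a cylinder \<open>G\<close> the two
  edge sets are eventually disjoint and independence gives equality; the limit then passes to
  complements and disjoint unions.\<close>

lemma mixing:
  fixes \<delta> :: "nat \<Rightarrow> site" and Y :: "edge \<Rightarrow> bool set"
  assumes \<delta>: "inj \<delta>" "\<And>n. \<delta> n \<in> sites" and K: "finite K" "K \<subseteq> edges"
    and G: "G \<in> sets (cost_space p)"
  defines "D \<equiv> \<lambda>n. translate (\<delta> n) -` cyl p K Y \<inter> space (cost_space p)"
  shows "(\<lambda>n. cost_space.prob p (G \<inter> D n)) \<longlonglongrightarrow> cost_space.prob p G * cost_space.prob p (cyl p K Y)"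
proof -
  let ?C = "{cyl p J X |J X. finite J \<and> J \<subseteq> edges}"
  have D_sets [measurable]: "D n \<in> sets (cost_space p)" for n
    unfolding D_def by (rule measurable_sets[OF measurable_translate[OF \<delta>(2)] cyl_sets[OF K]])
  have prob_D: "cost_space.prob p (D n) = cost_space.prob p (cyl p K Y)" for n
    unfolding D_def by (rule prob_translate[OF \<delta>(2) cyl_sets[OF K]])
  have "?C \<subseteq> Pow (space (cost_space p))" by (auto simp: cyl_def)
  moreover have "G \<in> sigma_sets (space (cost_space p)) ?C" using G by (simp only: sets_cost_space)
  ultimately show ?thesis
  proof (induction rule: sigma_sets_induct_disjoint
      [OF Int_stable_cyl, consumes 2, case_names basic empty compl union])
    case (basic A)
    then obtain J X where A: "A = cyl p J X" and J: "finite J" "J \<subseteq> edges" by blast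
    have "\<forall>\<^sub>F n in sequentially. cost_space.prob p (A \<inter> D n) = cost_space.prob p A * cost_space.prob p (cyl p K Y)"
      using eventually_disjoint_shift[OF J(1) K(1) J(2) K(2) \<delta>(1)]
    proof eventually_elim
      case (elim n)
      have "cost_space.prob p (A \<inter> D n) = cost_space.prob p A * cost_space.prob p (D n)"
        unfolding A D_def translate_cyl[OF \<delta>(2) K(2)]
        using elim J K shift_edges[OF \<delta>(2)] by (intro prob_cyl_Int_disjoint) auto
      then show ?case by (simp add: prob_D)
    qed
    then show ?case by (rule tendsto_eventually)
  next
    case empty
    then show ?case by simp
  next
    case (compl A)
    then have A [measurable]: "A \<in> sets (cost_space p)" by (simp only: sets_cost_space)
    have "cost_space.prob p ((space (cost_space p) - A) \<inter> D n) =
        cost_space.prob p (cyl p K Y) - cost_space.prob p (A \<inter> D n)" for n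
    proof -
      have "(space (cost_space p) - A) \<inter> D n = D n - A \<inter> D n"
        using sets.sets_into_space[OF D_sets[of n]] by blast
      then show ?thesis by (simp add: cost_space.finite_measure_Diff prob_D)
    qed
    moreover have "(\<lambda>n. cost_space.prob p (cyl p K Y) - cost_space.prob p (A \<inter> D n)) \<longlonglongrightarrow>
        cost_space.prob p (cyl p K Y) - cost_space.prob p A * cost_space.prob p (cyl p K Y)"
      using compl by (intro tendsto_intros)
    ultimately show ?case
      by (simp only: cost_space.prob_compl[OF A] left_diff_distrib mult_1)
  next
    case (union A)
    then have A [measurable]: "A i \<in> sets (cost_space p)" for i
      by (auto simp only: sets_cost_space)
    have sums: "(\<lambda>i. cost_space.prob p (A i)) sums cost_space.prob p (\<Union>i. A i)"
      using union(1) A by (intro cost_space.finite_measure_UNION) auto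
    have "(\<lambda>i. cost_space.prob p (A i \<inter> D n)) sums cost_space.prob p (\<Union>i. A i \<inter> D n)" for n
      using union(1) A by (intro cost_space.finite_measure_UNION) (auto simp: disjoint_family_on_def)
    then have "cost_space.prob p ((\<Union>i. A i) \<inter> D n) = (\<Sum>i. cost_space.prob p (A i \<inter> D n))" for n
      by (simp add: sums_iff)
    \<comment> \<open>Limit and sum are exchanged by dominated convergence for series, with the
      summable bound \<open>prob (A i)\<close>.\<close>
    moreover have "(\<lambda>n. \<Sum>i. cost_space.prob p (A i \<inter> D n)) \<longlonglongrightarrow>
        (\<Sum>i. cost_space.prob p (A i) * cost_space.prob p (cyl p K Y))"
      using union(3) sums
      by (intro conjunct2[OF conjunct2[OF tannerys_theorem[where M = "\<lambda>i. cost_space.prob p (A i)"]]])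
        (auto intro!: always_eventually cost_space.finite_measure_mono simp: sums_iff)
    moreover have "(\<Sum>i. cost_space.prob p (A i) * cost_space.prob p (cyl p K Y)) =
        cost_space.prob p (\<Union>i. A i) * cost_space.prob p (cyl p K Y)"
      using sums_mult2[OF sums] by (rule sums_unique[symmetric])
    ultimately show ?case by simp
  qed
qed

text \<open>For an invariant event the sequence in \<open>mixing\<close> is constant, so
  \<open>G\<close> is independent of every cylinder, hence of the whole \<sigma>-algebra and of
  itself.\<close>

lemma invariant_zero_one:
  fixes \<delta> :: "nat \<Rightarrow> site"
  assumes \<delta>: "inj \<delta>" "\<And>n. \<delta> n \<in> sites" and G: "G \<in> sets (cost_space p)"
    and inv: "\<And>n. AE \<omega> in cost_space p. translate (\<delta> n) \<omega> \<in> G \<longleftrightarrow> \<omega> \<in> G"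
  shows "cost_space.prob p G = 0 \<or> cost_space.prob p G = 1"
proof -
  let ?C = "{cyl p J X |J X. finite J \<and> J \<subseteq> edges}"
  have "cost_space.prob p (G \<inter> C) = cost_space.prob p G * cost_space.prob p C" if C: "C \<in> ?C" for C
  proof -
    obtain K Y where K: "C = cyl p K Y" "finite K" "K \<subseteq> edges" using C by blast
    have C_sets: "C \<in> sets (cost_space p)" using cyl_sets K by simp
    have "cost_space.prob p (G \<inter> (translate (\<delta> n) -` C \<inter> space (cost_space p))) = cost_space.prob p (G \<inter> C)" for n
    proof -
      note meas = measurable_sets[OF measurable_translate[OF \<delta>(2)[of n], of p]]
      have "cost_space.prob p (G \<inter> (translate (\<delta> n) -` C \<inter> space (cost_space p))) =
          cost_space.prob p (translate (\<delta> n) -` (G \<inter> C) \<inter> space (cost_space p))"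
        using inv[of n] meas[OF C_sets] meas[OF sets.Int[OF G C_sets]] G
        by (intro cost_space.finite_measure_eq_AE) auto
      then show ?thesis using prob_translate[OF \<delta>(2) sets.Int[OF G C_sets]] by simp
    qed
    then have "(\<lambda>n. cost_space.prob p (G \<inter> C)) \<longlonglongrightarrow> cost_space.prob p G * cost_space.prob p C"
      using mixing[OF \<delta> K(2,3) G, of Y] by (simp add: K(1))
    then show ?thesis by (rule LIMSEQ_unique[OF tendsto_const])
  qed
  then have "cost_space.indep_set p {G} ?C"
    using G by (intro cost_space.indep_setI) (auto intro: cyl_sets)
  then have "cost_space.indep_set p (sigma_sets (space (cost_space p)) {G}) (sigma_sets (space (cost_space p)) ?C)"
    by (rule cost_space.indep_set_sigma_sets[OF _ _ Int_stable_cyl]) (simp add: Int_stable_def)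
  then have "cost_space.prob p (G \<inter> G) = cost_space.prob p G * cost_space.prob p G"
    by (rule cost_space.indep_setD) (use G in \<open>simp_all only: sets_cost_space sigma_sets.Basic singletonI\<close>)
  then show ?thesis by simp
qed

section \<open>Measurability of the value up to null sets\<close>

lemma component_sets:
  "{\<omega> \<in> space (cost_space p). \<omega> e} \<in> sets (cost_space p)"
proof (cases "e \<in> edges")
  case True
  have "{\<omega> \<in> space (cost_space p). \<omega> e} = cyl p {e} (\<lambda>_. {True})" by (auto simp: cyl_def)
  then show ?thesis using cyl_sets[of "{e}" p] True by simp
next
  case False
  \<comment> \<open>States range over all integer points, so \<open>advance\<close> also reads pairs
    that are not edges; there every configuration has the same value.\<close>
  then have "\<omega> e = undefined" if "\<omega> \<in> space (cost_space p)" for \<omega>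
    using that by (auto simp: space_cost_space PiE_def extensional_def)
  then have "{\<omega> \<in> space (cost_space p). \<omega> e} = {\<omega> \<in> space (cost_space p). undefined}" by auto
  then show ?thesis by simp
qed

lemma all_action1: "(\<forall>a. P a) \<longleftrightarrow> P T \<and> P B"
  by (auto intro: action1.induct)

lemma ex_action2: "(\<exists>b. P b) \<longleftrightarrow> P L \<or> P R"
proof
  assume "\<exists>b. P b"
  then obtain b where "P b" ..
  then show "P L \<or> P R" by (cases b) auto
qed auto

text \<open>The successor state depends on the configuration only through the cost of one edge, and
  both action sets are finite.\<close>

lemma cpre_advance_sets:
  assumes X: "\<And>s. {\<omega> \<in> space (cost_space p). s \<in> X \<omega>} \<in> sets (cost_space p)"
  shows "{\<omega> \<in> space (cost_space p). s \<in> cpre (advance \<omega>) (X \<omega>)} \<in> sets (cost_space p)"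
proof -
  have adv: "{\<omega> \<in> space (cost_space p). advance \<omega> s a b \<in> X \<omega>} \<in> sets (cost_space p)" for a b
  proof -
    obtain w n k where s: "s = (w, n, k)" by (cases s)
    let ?e = "{w, move w a b}"
    have "{\<omega> \<in> space (cost_space p). advance \<omega> s a b \<in> X \<omega>} =
      {\<omega> \<in> space (cost_space p). \<omega> ?e \<and> (move w a b, Suc n, Suc k) \<in> X \<omega> \<or>
         \<not> \<omega> ?e \<and> (move w a b, Suc n, k) \<in> X \<omega>}"
      by (auto simp: s advance_def)
    also have "\<dots> \<in> sets (cost_space p)"
      by (intro sets.sets_Collect_disj sets.sets_Collect_conj sets.sets_Collect_neg X component_sets)
    finally show ?thesis .
  qed
  have "{\<omega> \<in> space (cost_space p). s \<in> cpre (advance \<omega>) (X \<omega>)} =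
    {\<omega> \<in> space (cost_space p). (advance \<omega> s T L \<in> X \<omega> \<or> advance \<omega> s T R \<in> X \<omega>) \<and>
       (advance \<omega> s B L \<in> X \<omega> \<or> advance \<omega> s B R \<in> X \<omega>)}"
    by (simp only: cpre_def mem_Collect_eq all_action1 ex_action2)
  also have "\<dots> \<in> sets (cost_space p)"
    by (intro sets.sets_Collect_disj sets.sets_Collect_conj adv)
  finally show ?thesis .
qed

lemma recur_advance_sets:
  assumes X: "\<And>s. {\<omega> \<in> space (cost_space p). s \<in> X \<omega>} \<in> sets (cost_space p)"
  shows "{\<omega> \<in> space (cost_space p). s \<in> recur (advance \<omega>) acc (X \<omega>)} \<in> sets (cost_space p)"
proof -
  have base: "{\<omega> \<in> space (cost_space p). s \<in> acc \<and> s \<in> cpre (advance \<omega>) (X \<omega>)} \<in> sets (cost_space p)" for s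
    by (intro sets.sets_Collect_conj cpre_advance_sets X) simp
  have "{\<omega> \<in> space (cost_space p). s \<in> reach (advance \<omega>) acc (X \<omega>) n} \<in> sets (cost_space p)" for s n
  proof (induction n arbitrary: s)
    case 0
    then show ?case using base by simp
  next
    case (Suc n)
    show ?case
      unfolding reach.simps Un_iff Int_iff
      by (intro sets.sets_Collect_disj base cpre_advance_sets Suc)
  qed
  then have "{\<omega> \<in> space (cost_space p). \<exists>n. s \<in> reach (advance \<omega>) acc (X \<omega>) n} \<in> sets (cost_space p)"
    by (intro sets.sets_Collect_countable_Ex)
  then show ?thesis by (simp add: recur_def)
qed

lemma val_gt_AE_measurable:
  "\<exists>G\<in>sets (cost_space p). AE \<omega> in cost_space p. ereal q < val \<omega> z \<longleftrightarrow> \<omega> \<in> G"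
proof -
  have "\<forall>q. \<exists>X. (\<forall>s. {\<omega> \<in> space (cost_space p). s \<in> X \<omega>} \<in> sets (cost_space p)) \<and>
      (AE \<omega> in cost_space p. X \<omega> = forcing q \<omega>)"
    unfolding forcing_def
    by (intro allI gfp_AE_measurable[OF cost_space.prob_space_axioms mono_recur] recur_advance_sets)
  from choice[OF this] obtain X where X: "\<And>q s. {\<omega> \<in> space (cost_space p). s \<in> X q \<omega>} \<in> sets (cost_space p)"
      and AE: "\<And>q. AE \<omega> in cost_space p. X q \<omega> = forcing q \<omega>"
    by blast
  \<comment> \<open>Each \<open>forcing q'\<close> is replaced by its measurable version;
    restricting to rational \<open>q'\<close> keeps the exceptional set null.\<close>
  define G where "G = {\<omega> \<in> space (cost_space p). \<exists>q'\<in>\<rat>. q < q' \<and> (z, 0, 0) \<in> X q' \<omega>}"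
  have "G \<in> sets (cost_space p)"
    unfolding G_def
    by (intro sets.sets_Collect_countable_Ex' sets.sets_Collect_conj X countable_rat) simp
  moreover have "AE \<omega> in cost_space p. \<forall>q'\<in>\<rat>. X q' \<omega> = forcing q' \<omega>"
    by (intro AE_ball_countable' AE countable_rat)
  then have "AE \<omega> in cost_space p. ereal q < val \<omega> z \<longleftrightarrow> \<omega> \<in> G"
    using AE_space by eventually_elim (auto simp: val_gt_iff_forcing G_def)
  ultimately show ?thesis by blast
qed

section \<open>Almost sure constancy of the value\<close>

lemma val_translate:
  assumes "d \<in> sites" shows "val (translate d \<omega>) 0 = val \<omega> d"
proof -
  have "val \<omega> (0 + d) = val (\<lambda>e. \<omega> (shift d e)) 0" by (rule val_shift)
  also have "\<dots> = val (translate d \<omega>) 0"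
    by (rule val_cong) (auto simp: translate_def sites_def zero_prod_def)
  finally show ?thesis by simp
qed

text \<open>The event that a given ray stays in \<open>{v > q}\<close> is contained in its translates along the ray,
  hence almost surely invariant.\<close>

lemma AE_no_diagonal_ray:
  assumes G: "G \<in> sets (cost_space p)" "cost_space.prob p G \<noteq> 1"
    and "z \<in> sites" "\<bar>s\<bar> = 1" "\<bar>t\<bar> = 1"
  shows "AE \<omega> in cost_space p. \<exists>k. translate (z + (s * int k, t * int k)) \<omega> \<notin> G"
proof -
  define \<delta> where "\<delta> n = (s * int n, t * int n)" for n
  have inj: "inj \<delta>" using \<open>\<bar>s\<bar> = 1\<close> by (auto simp: \<delta>_def inj_on_def)
  have \<delta>_sites: "\<delta> n \<in> sites" for n
  proof -
    have "odd s" "odd t" using \<open>\<bar>s\<bar> = 1\<close> \<open>\<bar>t\<bar> = 1\<close> by presburger+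
    then show ?thesis by (simp add: \<delta>_def sites_def)
  qed
  have z\<delta>: "z + \<delta> k \<in> sites" for k using \<open>z \<in> sites\<close> \<delta>_sites by (rule sites_add)
  define H where "H = {\<omega> \<in> space (cost_space p). \<forall>k. translate (z + \<delta> k) \<omega> \<in> G}"
  have "{\<omega> \<in> space (cost_space p). translate (z + \<delta> k) \<omega> \<in> G} \<in> sets (cost_space p)" for k
    using measurable_sets[OF measurable_translate[OF z\<delta>] G(1)] by (simp add: vimage_def Int_def conj_commute)
  then have H: "H \<in> sets (cost_space p)"
    unfolding H_def by (intro sets.sets_Collect_countable_All)
  have "cost_space.prob p H = 0 \<or> cost_space.prob p H = 1"
  proof (rule invariant_zero_one[OF inj \<delta>_sites H])
    fix n
    define H' where "H' = translate (\<delta> n) -` H \<inter> space (cost_space p)"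
    have H': "H' \<in> sets (cost_space p)"
      unfolding H'_def by (rule measurable_sets[OF measurable_translate[OF \<delta>_sites] H])
    have tr: "translate (z + \<delta> k) (translate (\<delta> n) \<omega>) = translate (z + \<delta> (k + n)) \<omega>" for k \<omega>
      using translate_translate[OF z\<delta>, of k "\<delta> n" \<omega>] by (simp add: \<delta>_def algebra_simps)
    have "H \<subseteq> H'"
      using measurable_space[OF measurable_translate[OF \<delta>_sites[of n]], of _ p]
      by (auto simp: H_def H'_def tr)
    moreover have "cost_space.prob p H' = cost_space.prob p H"
      unfolding H'_def by (rule prob_translate[OF \<delta>_sites H])
    ultimately have "cost_space.prob p (H' - H) = 0"
      using H H' by (simp add: cost_space.finite_measure_Diff)
    then have "AE \<omega> in cost_space p. \<omega> \<notin> H' - H"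
      using H H' by (simp add: cost_space.prob_eq_0)
    then show "AE \<omega> in cost_space p. translate (\<delta> n) \<omega> \<in> H \<longleftrightarrow> \<omega> \<in> H"
      using AE_space by eventually_elim (use \<open>H \<subseteq> H'\<close> in \<open>auto simp: H'_def\<close>)
  qed
  \<comment> \<open>The instance \<open>k = 0\<close> alone has the probability of \<open>G\<close>,
    so the zero-one law leaves only probability 0 for \<open>H\<close>.\<close>
  moreover have "cost_space.prob p H < 1"
  proof -
    have "cost_space.prob p H \<le> cost_space.prob p (translate z -` G \<inter> space (cost_space p))"
    proof (rule cost_space.finite_measure_mono)
      show "H \<subseteq> translate z -` G \<inter> space (cost_space p)"
      proof
        fix \<omega> assume "\<omega> \<in> H"
        then have "\<omega> \<in> space (cost_space p)" "translate (z + \<delta> 0) \<omega> \<in> G" by (auto simp: H_def)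
        then show "\<omega> \<in> translate z -` G \<inter> space (cost_space p)" by (simp add: \<delta>_def flip: zero_prod_def)
      qed
    qed (rule measurable_sets[OF measurable_translate[OF \<open>z \<in> sites\<close>] G(1)])
    also have "\<dots> = cost_space.prob p G" by (rule prob_translate[OF \<open>z \<in> sites\<close> G(1)])
    also have "\<dots> < 1" using G(2) cost_space.prob_le_1[of p G] by linarith
    finally show ?thesis .
  qed
  ultimately have "cost_space.prob p H = 0" by auto
  then have "AE \<omega> in cost_space p. \<omega> \<notin> H" using H by (simp add: cost_space.prob_eq_0)
  then show ?thesis using AE_space by eventually_elim (auto simp: H_def \<delta>_def)
qed

lemma AE_val_gt_translate:
  assumes "AE \<omega> in cost_space p. ereal q < val \<omega> 0 \<longleftrightarrow> \<omega> \<in> G"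
  shows "AE \<omega> in cost_space p. \<forall>z\<in>sites. ereal q < val \<omega> z \<longleftrightarrow> translate z \<omega> \<in> G"
proof -
  have "AE \<omega> in cost_space p. ereal q < val \<omega> z \<longleftrightarrow> translate z \<omega> \<in> G" if "z \<in> sites" for z
    using AE_translate[OF that assms] unfolding val_translate[OF that] .
  then show ?thesis by (intro AE_ball_countable' countableI_type)
qed

text \<open>If \<open>{v > q}\<close> almost surely contains the origin, it almost surely contains
  every site and no value lies below \<open>q\<close>. Otherwise almost surely none of the countably
  many diagonal rays stays in it, whereas separated values would produce one.\<close>

lemma AE_val_not_separated:
  "AE \<omega> in cost_space p. \<not> (\<exists>z\<in>sites. \<exists>w\<in>sites. val \<omega> w < ereal q \<and> ereal q < val \<omega> z)"
proof -
  obtain G where G: "G \<in> sets (cost_space p)" "AE \<omega> in cost_space p. ereal q < val \<omega> 0 \<longleftrightarrow> \<omega> \<in> G"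
    using val_gt_AE_measurable by blast
  note tr = AE_val_gt_translate[OF G(2)]
  show ?thesis
  proof (cases "cost_space.prob p G = 1")
    case True
    then have "AE \<omega> in cost_space p. \<omega> \<in> G" using G(1) by (simp add: cost_space.prob_eq_1)
    then have "AE \<omega> in cost_space p. \<forall>z\<in>sites. translate z \<omega> \<in> G"
      by (intro AE_ball_countable' countableI_type AE_translate)
    with tr show ?thesis by eventually_elim (meson less_asym)
  next
    case False
    have "AE \<omega> in cost_space p. \<forall>z\<in>sites. \<forall>s\<in>{- 1, 1}. \<forall>t\<in>{- 1, 1}.
        \<exists>k. translate (z + (s * int k, t * int k)) \<omega> \<notin> G"
      by (intro AE_ball_countable' countableI_type AE_no_diagonal_ray[OF G(1) False]) auto
    with tr show ?thesis
    proof eventually_elim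
      case (elim \<omega>)
      show ?case
      proof
        assume "\<exists>z\<in>sites. \<exists>w\<in>sites. val \<omega> w < ereal q \<and> ereal q < val \<omega> z"
        then obtain z w where zw: "z \<in> sites" "w \<in> sites" "val \<omega> w < ereal q" "ereal q < val \<omega> z" by blast
        define A where "A = {z \<in> sites. ereal q < val \<omega> z}"
        define C where "C = {z \<in> sites. val \<omega> z < ereal q}"
        have "\<exists>z\<in>A. \<exists>s t. \<bar>s\<bar> = 1 \<and> \<bar>t\<bar> = 1 \<and> (\<forall>k. z + (s * int k, t * int k) \<in> A)"
        proof (rule diagonal_ray[of A C])
          show "\<exists>b. move z a b \<in> A" if "z \<in> A" for z a
            using that val_gt_step[of "ereal q" \<omega> z a] by (auto simp: A_def move_sites)
          show "\<exists>a. \<forall>b. move z a b \<in> C" if "z \<in> C" for z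
            using that val_less_step[of \<omega> z "ereal q"] by (auto simp: C_def move_sites)
          show "A \<noteq> {}" "C \<noteq> {}" unfolding A_def C_def using zw by blast+
        qed (auto simp: A_def C_def)
        then obtain x s t where "x \<in> A" and st: "\<bar>s\<bar> = 1" "\<bar>t\<bar> = 1"
            and ray: "\<And>k. x + (s * int k, t * int k) \<in> A" by blast
        have "s \<in> {- 1, 1}" "t \<in> {- 1, 1}" using st by auto
        then obtain k where "translate (x + (s * int k, t * int k)) \<omega> \<notin> G"
          using elim(2) \<open>x \<in> A\<close> unfolding A_def by blast
        then show False using elim(1) ray[of k] by (auto simp: A_def)
      qed
    qed
  qed
qed

lemma AE_val_const: "AE \<omega> in cost_space p. \<forall>z\<in>sites. val \<omega> z = val \<omega> 0"
proof -
  have "AE \<omega> in cost_space p. \<forall>q\<in>\<rat>. \<not> (\<exists>z\<in>sites. \<exists>w\<in>sites. val \<omega> w < ereal q \<and> ereal q < val \<omega> z)"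
    by (intro AE_ball_countable' AE_val_not_separated countable_rat)
  then show ?thesis
  proof eventually_elim
    case (elim \<omega>)
    have le: "val \<omega> z \<le> val \<omega> w" if "z \<in> sites" "w \<in> sites" for z w
    proof (rule ccontr)
      assume "\<not> val \<omega> z \<le> val \<omega> w"
      then have "val \<omega> w < val \<omega> z" by simp
      then obtain q where "q \<in> \<rat>" "val \<omega> w < ereal q" "ereal q < val \<omega> z"
        using ereal_dense_Rats by blast
      then show False using elim that \<open>q \<in> \<rat>\<close> by blast
    qed
    have "(0 :: site) \<in> sites" by (simp add: sites_def zero_prod_def)
    then show ?case using le by (meson antisym)
  qed
qed

lemma AE_val_eq_const: "\<exists>v::real. 0 \<le> v \<and> v \<le> 1 \<and> (AE \<omega> in cost_space p. \<forall>z\<in>sites. val \<omega> z = ereal v)"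
proof -
  have "\<exists>b. AE \<omega> in cost_space p. ereal q < val \<omega> 0 \<longleftrightarrow> b" for q
  proof -
    obtain G where G: "G \<in> sets (cost_space p)" "AE \<omega> in cost_space p. ereal q < val \<omega> 0 \<longleftrightarrow> \<omega> \<in> G"
      using val_gt_AE_measurable by blast
    define \<delta> where "\<delta> n = (int n, int n)" for n
    have \<delta>_sites: "\<delta> n \<in> sites" for n by (simp add: \<delta>_def sites_def)
    have "cost_space.prob p G = 0 \<or> cost_space.prob p G = 1"
    proof (rule invariant_zero_one[OF _ \<delta>_sites G(1)])
      show "inj \<delta>" by (auto simp: \<delta>_def inj_on_def)
      \<comment> \<open>Up to null sets, translating \<open>\<omega>\<close> moves the starting
        site, and the value has just been shown not to depend on it.\<close>
      show "AE \<omega> in cost_space p. translate (\<delta> n) \<omega> \<in> G \<longleftrightarrow> \<omega> \<in> G" for n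
        using AE_val_gt_translate[OF G(2)] AE_val_const G(2)
        by eventually_elim (use \<delta>_sites in auto)
    qed
    then have "(AE \<omega> in cost_space p. \<omega> \<notin> G) \<or> (AE \<omega> in cost_space p. \<omega> \<in> G)"
      using G(1) by (simp add: cost_space.prob_eq_0 cost_space.prob_eq_1)
    then show ?thesis
    proof
      assume "AE \<omega> in cost_space p. \<omega> \<notin> G"
      with G(2) have "AE \<omega> in cost_space p. ereal q < val \<omega> 0 \<longleftrightarrow> False"
        by eventually_elim simp
      then show ?thesis by (rule exI)
    next
      assume "AE \<omega> in cost_space p. \<omega> \<in> G"
      with G(2) have "AE \<omega> in cost_space p. ereal q < val \<omega> 0 \<longleftrightarrow> True"
        by eventually_elim simp
      then show ?thesis by (rule exI)
    qed
  qed
  then obtain b where b: "\<And>q. AE \<omega> in cost_space p. ereal q < val \<omega> 0 \<longleftrightarrow> b q" by metis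
  have AE: "AE \<omega> in cost_space p. \<forall>q\<in>\<rat>. ereal q < val \<omega> 0 \<longleftrightarrow> b q"
    by (intro AE_ball_countable' b countable_rat)
  \<comment> \<open>The constant is the value at one typical configuration. All others satisfying
    the same equivalences have the same rationals below their value.\<close>
  from AE obtain \<omega>0 where \<omega>0: "\<forall>q\<in>\<rat>. ereal q < val \<omega>0 0 \<longleftrightarrow> b q"
    using eventually_happens'[OF cost_space.ae_filter_bot] by blast
  have "\<bar>val \<omega>0 0\<bar> \<noteq> \<infinity>" using val_nonneg[of \<omega>0 0] val_le_1[of \<omega>0 0] by auto
  then obtain v where v: "val \<omega>0 0 = ereal v" by auto
  have "AE \<omega> in cost_space p. \<forall>z\<in>sites. val \<omega> z = ereal v"
    using AE AE_val_const
  proof eventually_elim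
    case (elim \<omega>)
    have q: "ereal q < val \<omega> 0 \<longleftrightarrow> q < v" if "q \<in> \<rat>" for q
      using elim(1) \<omega>0 that v by simp
    have "val \<omega> 0 = ereal v"
    proof (rule antisym)
      show "val \<omega> 0 \<le> ereal v"
      proof (rule ccontr)
        assume "\<not> val \<omega> 0 \<le> ereal v"
        then obtain r where "r \<in> \<rat>" "ereal v < ereal r" "ereal r < val \<omega> 0"
          using ereal_dense_Rats[of "ereal v" "val \<omega> 0"] by (auto simp: not_le)
        then show False using q by auto
      qed
      show "ereal v \<le> val \<omega> 0"
      proof (rule ccontr)
        assume "\<not> ereal v \<le> val \<omega> 0"
        then obtain r where "r \<in> \<rat>" "val \<omega> 0 < ereal r" "ereal r < ereal v"
          using ereal_dense_Rats[of "val \<omega> 0" "ereal v"] by (auto simp: not_le)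
        then show False using q[of r] by auto
      qed
    qed
    then show ?case using elim(2) by simp
  qed
  moreover have "0 \<le> v" "v \<le> 1" using val_nonneg[of \<omega>0 0] val_le_1[of \<omega>0 0] v by auto
  ultimately show ?thesis by blast
qed

section \<open>Transfer to an arbitrary family of i.i.d. costs\<close>

lemma edges_nonempty: "edges \<noteq> {}"
  using move_edge[of "(0, 0)" T L] by (auto simp: sites_def)

theorem theorem4p1:
  fixes M :: "'w measure" and c :: "edge \<Rightarrow> 'w \<Rightarrow> bool" and p :: real
  assumes "prob_space M"
    and "0 \<le> p" and "p \<le> 1"
    and "prob_space.indep_vars M (\<lambda>_. count_space UNIV) c edges"
    and "\<And>e. e \<in> edges \<Longrightarrow> distr M (count_space UNIV) (c e) = measure_pmf (bernoulli_pmf p)"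
  shows "\<exists>v\<^sub>p::real. 0 \<le> v\<^sub>p \<and> v\<^sub>p \<le> 1 \<and>
           (AE \<omega> in M. \<forall>z\<in>sites. is_game_value (\<lambda>e. c e \<omega>) z v\<^sub>p)"
proof -
  interpret M: prob_space M by fact
  define N where "N = PiM edges (\<lambda>_. count_space (UNIV :: bool set))"
  define C where "C \<omega> = (\<lambda>e\<in>edges. c e \<omega>)" for \<omega>
  have rv: "c e \<in> measurable M (count_space UNIV)" if "e \<in> edges" for e
    using assms(4) that unfolding M.indep_vars_def by blast
  then have C: "C \<in> measurable M N"
    unfolding C_def N_def by (intro measurable_restrict)
  \<comment> \<open>Independence says exactly that the joint law of the costs is the product of
    their laws, so the almost sure statement can be pulled back along \<open>C\<close>.\<close>
  have "distr M N C = PiM edges (\<lambda>e. distr M (count_space UNIV) (c e))"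
    using M.indep_vars_iff_distr_eq_PiM'[where X = c and M' = "\<lambda>_. count_space UNIV",
        OF edges_nonempty rv] assms(4)
    unfolding N_def C_def by simp
  also have "\<dots> = cost_space p"
    unfolding cost_space_def using assms(5) by (intro PiM_cong) auto
  finally have distr: "distr M N C = cost_space p" .
  obtain v where v: "0 \<le> v" "v \<le> 1" "AE \<omega> in cost_space p. \<forall>z\<in>sites. val \<omega> z = ereal v"
    using AE_val_eq_const by blast
  have "AE \<omega> in M. \<forall>z\<in>sites. val (C \<omega>) z = ereal v"
    by (rule AE_distrD[OF C]) (subst distr, rule v(3))
  moreover have "val (C \<omega>) z = val (\<lambda>e. c e \<omega>) z" if "z \<in> sites" for z \<omega>
    using that by (rule val_cong) (simp add: C_def)
  ultimately have "AE \<omega> in M. \<forall>z\<in>sites. is_game_value (\<lambda>e. c e \<omega>) z v"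
    by (simp add: is_game_value_iff)
  then show ?thesis using v by blast
qed

end
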